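(* Let $u$ be a solution of $$\Delta_{g_{prod}} u + e^{2u} = 0$$ with finite total curvature, i.e. $\int_{S^1\times\mathbb{R}} e^{2u}\, dg_{prod}<\infty$, on the flat cylinder $(S^1\times\mathbb{R}, g_{prod})$. Then there exist $\mu\in[0,\infty)$ and $\beta\in(-1,\infty)$ such that either $\beta$ is an integer or $\mu=0$, and, up to a rescaling, $$e^{2u(z)}=\frac{(2\beta+2)^2|z|^{2\beta+2}}{\left(|1+\mu z^{\beta+1}|^2+|z|^{2\beta+2}\right)^2}\qquad\text{on } \left(\mathbb{C}\setminus\{0\}, \tfrac{1}{|z|^2}g_0\right).$$
   Context: Here $g_{prod}=dt^2+d\theta^2$ is the flat product metric on $S^1\times\mathbb{R}$, with $\theta$ the angular coordinate on $S^1$ and $t$ the coordinate on $\mathbb{R}$, and $g_0$ is the Euclidean metric on $\mathbb{C}=\mathbb{R}^2$. The cylinder is identified with $(\mathbb{C}\setminus\{0\}, \frac{1}{|z|^2}g_0)$ by setting $t=\ln r$, where $(r,\theta)$ are polar coordinates, $z=re^{i\theta}$, so that $dt^2+d\theta^2=\frac{1}{r^2}g_0$. $\Delta_{g_{prod}}$ is the Laplace–Beltrami operator and $dg_{prod}$ the area measure of $g_{prod}$. *)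

theory Defs
  imports "HOL-Analysis.Analysis"
begin

definition cylinder :: "(complex \<times> real) set" where
  "cylinder = sphere 0 1 \<times> UNIV"

(* The coordinates (\<theta>, t) |-> (cis \<theta>, t) are a local isometry from the Euclidean plane onto
   the cylinder with the product metric d\<theta>^2 + dt^2; regularity on the cylinder is regularity
   in these coordinates. *)
definition cyl_lift :: "(complex \<times> real \<Rightarrow> real) \<Rightarrow> real \<times> real \<Rightarrow> real" where
  "cyl_lift u = (\<lambda>(\<theta>, t). u (cis \<theta>, t))"

definition C2 :: "('a::real_normed_vector \<Rightarrow> 'b::real_normed_vector) \<Rightarrow> bool" where
  "C2 f \<longleftrightarrow>
     (\<exists>(f' :: 'a \<Rightarrow> 'a \<Rightarrow>\<^sub>L 'b) (f'' :: 'a \<Rightarrow> 'a \<Rightarrow>\<^sub>L ('a \<Rightarrow>\<^sub>L 'b)).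
        (\<forall>x. (f has_derivative blinfun_apply (f' x)) (at x)) \<and>
        (\<forall>x. (f' has_derivative blinfun_apply (f'' x)) (at x)) \<and>
        continuous_on UNIV f'')"

(* The Laplace-Beltrami operator of d\<theta>^2 + dt^2, that is, the sum of the second derivatives in
   \<theta> and t. If w = cis \<theta> then cis s * w = cis (\<theta> + s), so the first summand is the second
   \<theta>-derivative at w. *)
definition cyl_laplacian :: "(complex \<times> real \<Rightarrow> real) \<Rightarrow> complex \<times> real \<Rightarrow> real" where
  "cyl_laplacian u = (\<lambda>(w, t).
     deriv (deriv (\<lambda>s. u (cis s * w, t))) 0 + deriv (deriv (\<lambda>s. u (w, s))) t)"

definition arc_length :: "complex measure" where
  "arc_length = distr (restrict_space lborel {0..<2 * pi}) (restrict_space borel (sphere 0 1)) cis"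

(* The area measure of d\<theta>^2 + dt^2; its underlying space is the set cylinder. *)
definition cyl_area :: "(complex \<times> real) measure" where
  "cyl_area = arc_length \<Otimes>\<^sub>M lborel"

(* The identification of the punctured plane with the cylinder given by t = ln r:
   z = r * cis \<theta> with r > 0 goes to (cis \<theta>, ln r). *)
definition cyl_point :: "complex \<Rightarrow> complex \<times> real" where
  "cyl_point z = (sgn z, ln (cmod z))"

end

theory Submission
  imports Defs "HOL-Complex_Analysis.Complex_Analysis"
begin

text \<open>
  In the coordinate \<open>w = t + i\<theta>\<close> a solution \<open>u\<close> is a function on the plane with period \<open>2\<pi>i\<close>,
  and \<open>T = u_ww - (u_w)^2\<close> is entire. The function \<open>h = exp (-u)\<close> satisfies the linear equation
  \<open>h_ww = - T h\<close>, so once \<open>T\<close> is known to be constant, \<open>h\<close> is a combination of four exponentials,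
  and periodicity and positivity leave only the asserted solutions.

  To see that \<open>T\<close> is constant, pair the linear equation with the antiholomorphic function \<open>cnj T\<close>
  over the circles \<open>t = const\<close>: with \<open>Y = \<integral> h cnj T d\<theta>\<close> and \<open>X = \<integral> |T|^2 h d\<theta>\<close> one gets \<open>Y'' = -4 X\<close>.
  Finite area bounds the circle means of \<open>u\<close> linearly in \<open>t\<close>, and \<open>-u\<close> is subharmonic, so \<open>h\<close> grows
  at most exponentially. A cut-off of the identity for \<open>Y''\<close> and \<open>|T| \<le> |T|^2 h + exp u\<close> show that
  \<open>T\<close> grows at most exponentially, hence is a Laurent polynomial in \<open>exp w\<close>. If it were
  unbounded at an end of the cylinder, then \<open>|T|\<close> would tend to infinity there, and the same identity would force
  \<open>Y\<close> to grow faster than any exponential.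
\<close>

section \<open>Wirtinger derivatives\<close>

text \<open>Nothing is known beforehand about \<open>u\<close> at the ends of the cylinder, so as a
  function of \<open>exp w\<close> the entire function \<open>T\<close> could have essential
  singularities. The pairing with \<open>cnj T\<close> avoids this: \<open>cnj T\<close> passes
  through the \<open>w\<close>-derivative, and \<open>- T * h\<close> times \<open>cnj T\<close> has
  a sign whatever the argument of \<open>T\<close>. The resulting convexity in \<open>t\<close> is
  used in two ways. Tested with a cut-off, it is an interior estimate that presupposes no bound on
  \<open>T\<close>. Where \<bar>T\<bar> is large, it is a differential inequality whose rate of
  growth exceeds the one granted by the first use. The four exponentials are
  \<open>exp (s * w + r * cnj w)\<close> with \<open>s\<^sup>2 = - T\<close> and
  \<open>r\<^sup>2 = - cnj T\<close>. Periodicity makes \<open>s\<close> real. Equal signs of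
  \<open>s\<close> and \<open>r\<close> give growth and decay in \<open>t\<close>, opposite signs
  give oscillation in \<theta> with frequency \<beta> + 1, the double of \<bar>s\<bar>. A nonzero
  oscillating term must fit the period: this is the alternative that \<beta> is an integer or \<mu>
  = 0.\<close>

definition has_wirtinger ::
    "(complex \<Rightarrow> complex) \<Rightarrow> (complex \<Rightarrow> complex) \<Rightarrow> (complex \<Rightarrow> complex) \<Rightarrow> bool" where
  "has_wirtinger f p q \<longleftrightarrow>
     (\<forall>w. (f has_derivative (\<lambda>d. p w * d + q w * cnj d)) (at w))"

lemma has_wirtingerD:
  "has_wirtinger f p q \<Longrightarrow> (f has_derivative (\<lambda>d. p w * d + q w * cnj d)) (at w)"
  by (simp add: has_wirtinger_def)

lemma has_wirtinger_continuous: "has_wirtinger f p q \<Longrightarrow> continuous_on S f"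
  by (meson has_wirtingerD has_derivative_continuous continuous_at_imp_continuous_on)

lemma has_wirtinger_const: "has_wirtinger (\<lambda>w. c) (\<lambda>w. 0) (\<lambda>w. 0)"
  by (simp add: has_wirtinger_def)

lemma has_wirtinger_add:
  assumes "has_wirtinger f p q" "has_wirtinger g r s"
  shows "has_wirtinger (\<lambda>w. f w + g w) (\<lambda>w. p w + r w) (\<lambda>w. q w + s w)"
  unfolding has_wirtinger_def
  by (auto intro!: derivative_eq_intros has_wirtingerD[OF assms(1)] has_wirtingerD[OF assms(2)]
      simp: algebra_simps)

lemma has_wirtinger_diff:
  assumes "has_wirtinger f p q" "has_wirtinger g r s"
  shows "has_wirtinger (\<lambda>w. f w - g w) (\<lambda>w. p w - r w) (\<lambda>w. q w - s w)"
  unfolding has_wirtinger_def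
  by (auto intro!: derivative_eq_intros has_wirtingerD[OF assms(1)] has_wirtingerD[OF assms(2)]
      simp: algebra_simps)

lemma has_wirtinger_mult:
  assumes "has_wirtinger f p q" "has_wirtinger g r s"
  shows "has_wirtinger (\<lambda>w. f w * g w) (\<lambda>w. p w * g w + f w * r w) (\<lambda>w. q w * g w + f w * s w)"
  unfolding has_wirtinger_def
  by (auto intro!: derivative_eq_intros has_wirtingerD[OF assms(1)] has_wirtingerD[OF assms(2)]
      simp: algebra_simps)

lemma has_wirtinger_cmult:
  assumes "has_wirtinger f p q"
  shows "has_wirtinger (\<lambda>w. c * f w) (\<lambda>w. c * p w) (\<lambda>w. c * q w)"
  using has_wirtinger_mult[OF has_wirtinger_const[of c] assms] by simp

lemma has_wirtinger_cnj:
  assumes "has_wirtinger f p q"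
  shows "has_wirtinger (\<lambda>w. cnj (f w)) (\<lambda>w. cnj (q w)) (\<lambda>w. cnj (p w))"
  unfolding has_wirtinger_def
proof
  fix w
  show "((\<lambda>w. cnj (f w)) has_derivative (\<lambda>d. cnj (q w) * d + cnj (p w) * cnj d)) (at w)"
    using bounded_linear.has_derivative[OF bounded_linear_cnj has_wirtingerD[OF assms, of w]]
    by (simp add: algebra_simps)
qed

lemma has_wirtinger_holomorphic:
  assumes "\<And>w. (f has_field_derivative f' w) (at w)"
  shows "has_wirtinger f f' (\<lambda>w. 0)"
  unfolding has_wirtinger_def
  using assms by (simp add: has_field_derivative_def)

lemma has_wirtinger_chain_left:
  assumes "has_wirtinger f p q" "\<And>z. (g has_field_derivative g' z) (at z)"
  shows "has_wirtinger (\<lambda>w. g (f w)) (\<lambda>w. g' (f w) * p w) (\<lambda>w. g' (f w) * q w)"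
  unfolding has_wirtinger_def
proof
  fix w
  show "((\<lambda>w. g (f w)) has_derivative (\<lambda>d. g' (f w) * p w * d + g' (f w) * q w * cnj d)) (at w)"
    using has_derivative_compose[OF has_wirtingerD[OF assms(1), of w]
        assms(2)[of "f w", unfolded has_field_derivative_def]]
    by (simp add: algebra_simps)
qed

lemma has_wirtinger_chain_right:
  assumes "has_wirtinger f p q" "\<And>z. (g has_field_derivative g' z) (at z)"
  shows "has_wirtinger (\<lambda>w. f (g w)) (\<lambda>w. p (g w) * g' w) (\<lambda>w. q (g w) * cnj (g' w))"
  unfolding has_wirtinger_def
proof
  fix w
  show "((\<lambda>w. f (g w)) has_derivative (\<lambda>d. p (g w) * g' w * d + q (g w) * cnj (g' w) * cnj d)) (at w)"
    using has_derivative_compose[OF assms(2)[of w, unfolded has_field_derivative_def]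
        has_wirtingerD[OF assms(1), of "g w"]]
    by (simp add: algebra_simps)
qed

text \<open>Evaluating the differential at \<open>1\<close> and at \<open>\<i>\<close> recovers
  \<open>p + q\<close> and \<open>p - q\<close> separately.\<close>

lemma has_wirtinger_unique:
  assumes "has_wirtinger f p q" "has_wirtinger f r s"
  shows "p w = r w" "q w = s w"
proof -
  have eq: "p w * d + q w * cnj d = r w * d + s w * cnj d" for d
    using has_derivative_unique[OF has_wirtingerD[OF assms(1)] has_wirtingerD[OF assms(2)], of w]
    by meson
  have "\<i> * (p w - q w) = \<i> * (r w - s w)"
    using eq[of \<i>] by (simp add: algebra_simps)
  then have "p w - q w = r w - s w" by (metis complex_i_not_zero mult_left_cancel)
  moreover have "p w + q w = r w + s w" using eq[of 1] by simp
  ultimately show "p w = r w" "q w = s w"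
    by (simp_all add: complex_eq_iff)
qed

lemma has_wirtinger_cong:
  assumes "has_wirtinger f p q" "\<And>w. f w = g w" "\<And>w. p w = r w" "\<And>w. q w = s w"
  shows "has_wirtinger g r s"
proof -
  have "f = g" "p = r" "q = s" using assms by auto
  with assms(1) show ?thesis by simp
qed

lemma has_wirtinger_zero_constant:
  assumes "has_wirtinger f p q" "\<And>w. p w = 0" "\<And>w. q w = 0"
  shows "f w = f z"
proof -
  have "(f has_derivative (\<lambda>d. 0)) (at w within UNIV)" for w
    using has_wirtingerD[OF assms(1), of w] assms by simp
  then obtain c where "\<And>w. w \<in> UNIV \<Longrightarrow> f w = c"
    using has_derivative_zero_constant[of UNIV f] by auto
  then show ?thesis by simp
qed

lemma has_wirtinger_periodic:
  assumes "has_wirtinger f p q" "\<And>w. f (w + c) = f w"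
  shows "p (w + c) = p w" "q (w + c) = q w"
proof -
  have "has_wirtinger (\<lambda>w. f (w + c)) (\<lambda>w. p (w + c) * 1) (\<lambda>w. q (w + c) * cnj 1)"
    by (rule has_wirtinger_chain_right[OF assms(1)]) (auto intro!: derivative_eq_intros)
  then have "has_wirtinger f (\<lambda>w. p (w + c)) (\<lambda>w. q (w + c))"
    using assms(2) by simp
  from has_wirtinger_unique[OF this assms(1)]
  show "p (w + c) = p w" "q (w + c) = q w" by auto
qed

lemma has_wirtinger_Complex_left:
  assumes "has_wirtinger f p q"
  shows "((\<lambda>t. f (Complex t y)) has_vector_derivative (p (Complex t y) + q (Complex t y)))
           (at t within S)"
proof -
  have "((\<lambda>t. Complex t y) has_derivative (\<lambda>d. of_real d)) (at t within S)"
    unfolding Complex_eq by (auto intro!: derivative_eq_intros)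
  from has_derivative_compose[OF this has_wirtingerD[OF assms, of "Complex t y"]]
  show ?thesis
    by (simp add: has_vector_derivative_def scaleR_conv_of_real algebra_simps)
qed

lemma has_wirtinger_Complex_right:
  assumes "has_wirtinger f p q"
  shows "((\<lambda>y. f (Complex t y)) has_vector_derivative \<i> * (p (Complex t y) - q (Complex t y)))
           (at y within S)"
proof -
  have "((\<lambda>y. Complex t y) has_derivative (\<lambda>d. \<i> * of_real d)) (at y within S)"
    unfolding Complex_eq by (auto intro!: derivative_eq_intros)
  from has_derivative_compose[OF this has_wirtingerD[OF assms, of "Complex t y"]]
  show ?thesis
    by (simp add: has_vector_derivative_def scaleR_conv_of_real algebra_simps)
qed

text \<open>\<open>p + q\<close> and \<open>\<i> * (p - q)\<close> are the partial derivatives in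
  the real and imaginary directions, so this is differentiability from continuous partial
  derivatives in Wirtinger form.\<close>

lemma has_wirtingerI_partials:
  assumes dx: "\<And>x y. ((\<lambda>x. f (Complex x y)) has_vector_derivative (p (Complex x y) + q (Complex x y))) (at x)"
    and dy: "\<And>x y. ((\<lambda>y. f (Complex x y)) has_vector_derivative \<i> * (p (Complex x y) - q (Complex x y))) (at y)"
    and cont: "continuous_on UNIV p" "continuous_on UNIV q"
  shows "has_wirtinger f p q"
  unfolding has_wirtinger_def
proof
  fix w :: complex
  define F where "F = (\<lambda>x y. f (Complex x y))"
  define fy where "fy = (\<lambda>x y. blinfun_scaleR_left (\<i> * (p (Complex x y) - q (Complex x y))))"
  have c: "continuous_on UNIV (\<lambda>(x, y). fy x y)"
    unfolding fy_def split_beta Complex_eq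
    by (intro continuous_intros continuous_on_compose2[OF cont(1)] continuous_on_compose2[OF cont(2)]) auto
  have "((\<lambda>(x, y). F x y) has_derivative
      (\<lambda>(tx, ty). tx *\<^sub>R (p w + q w) + blinfun_apply (fy (Re w) (Im w)) ty))
      (at (Re w, Im w) within UNIV \<times> UNIV)"
  proof (rule has_derivative_partialsI)
    show "((\<lambda>x. F x (Im w)) has_derivative (\<lambda>tx. tx *\<^sub>R (p w + q w))) (at (Re w) within UNIV)"
      using dx[of "Im w" "Re w"] by (simp add: F_def has_vector_derivative_def)
    show "(F x has_derivative blinfun_apply (fy x y)) (at y within UNIV)" for x y
      using dy[of x y] by (simp add: F_def fy_def has_vector_derivative_def)
    show "continuous (at (Re w, Im w) within UNIV \<times> UNIV) (\<lambda>(x, y). fy x y)"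
      using c by (auto simp: continuous_on_eq_continuous_within)
  qed auto
  then have D: "((\<lambda>(x, y). F x y) has_derivative
      (\<lambda>(tx, ty). tx *\<^sub>R (p w + q w) + blinfun_apply (fy (Re w) (Im w)) ty)) (at (Re w, Im w))"
    by simp
  have "((\<lambda>w. (Re w, Im w)) has_derivative (\<lambda>w. (Re w, Im w))) (at w)"
    by (auto intro!: derivative_eq_intros)
  from has_derivative_compose[OF this D]
  have "(f has_derivative (\<lambda>d. Re d *\<^sub>R (p w + q w) + Im d *\<^sub>R (\<i> * (p w - q w)))) (at w)"
    by (simp add: F_def fy_def)
  also have "(\<lambda>d. Re d *\<^sub>R (p w + q w) + Im d *\<^sub>R (\<i> * (p w - q w))) = (\<lambda>d. p w * d + q w * cnj d)"
    by (auto simp: fun_eq_iff complex_eq_iff algebra_simps)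
  finally show "(f has_derivative (\<lambda>d. p w * d + q w * cnj d)) (at w)" .
qed

lemma continuous_on_Complex_arg:
  assumes "continuous_on UNIV f" "continuous_on S g" "continuous_on S k"
  shows "continuous_on S (\<lambda>x. f (Complex (g x) (k x)))"
  using assms(2,3) unfolding Complex_eq
  by (intro continuous_on_compose2[OF assms(1)] continuous_intros) auto

text \<open>The form \<open>p dw + q d(cnj w)\<close> is closed because the
  \<open>cnj w\<close>-derivative of \<open>p\<close> and the \<open>w\<close>-derivative of
  \<open>q\<close> are the same function \<open>r\<close>. The primitive is its integral along the
  segment from \<open>0\<close>.\<close>

lemma poincare_wirtinger:
  assumes p: "has_wirtinger p p1 r" and q: "has_wirtinger q r q2"
    and cont: "continuous_on UNIV r" "continuous_on UNIV p1" "continuous_on UNIV q2"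
  shows "\<exists>P. has_wirtinger P p q"
proof -
  note cp = has_wirtinger_continuous[OF p, of UNIV] and cq = has_wirtinger_continuous[OF q, of UNIV]
  define g where "g = (\<lambda>(s::real) w. p (of_real s * w) * w + q (of_real s * w) * cnj w)"
  \<comment> \<open>Since both cross derivatives are \<open>r\<close>, the
    \<open>w\<close>-derivative of \<open>g s\<close> is also the \<open>s\<close>-derivative of
    \<open>of_real s * p (of_real s * w)\<close>, and its integral over \<open>[0, 1]\<close> is
    \<open>p w\<close>. The same holds for \<open>\<beta>\<close> and \<open>q\<close>.\<close>
  define \<alpha> where "\<alpha> = (\<lambda>(s::real) w. p (of_real s * w) + of_real s * (p1 (of_real s * w) * w + r (of_real s * w) * cnj w))"
  define \<beta> where "\<beta> = (\<lambda>(s::real) w. q (of_real s * w) + of_real s * (r (of_real s * w) * w + q2 (of_real s * w) * cnj w))"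
  have id: "has_wirtinger (\<lambda>w. w) (\<lambda>w. 1) (\<lambda>w. 0)"
    by (rule has_wirtinger_holomorphic) (auto intro!: derivative_eq_intros)
  have scale: "has_wirtinger (\<lambda>w. f (of_real s * w)) (\<lambda>w. f1 (of_real s * w) * of_real s) (\<lambda>w. f2 (of_real s * w) * cnj (of_real s))"
    if "has_wirtinger f f1 f2" for f f1 f2 and s :: real
    by (rule has_wirtinger_chain_right[OF that]) (auto intro!: derivative_eq_intros)
  have g: "has_wirtinger (g s) (\<alpha> s) (\<beta> s)" for s
    unfolding g_def
    by (rule has_wirtinger_cong[OF has_wirtinger_add[OF has_wirtinger_mult[OF scale[OF p] id]
            has_wirtinger_mult[OF scale[OF q] has_wirtinger_cnj[OF id]]]])
       (auto simp: \<alpha>_def \<beta>_def algebra_simps)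
  have ccomp: "continuous_on S (\<lambda>x. f (k x))" if "continuous_on UNIV f" "continuous_on S k"
    for f :: "complex \<Rightarrow> complex" and S :: "'z::topological_space set" and k
    using continuous_on_compose2[OF that] by auto
  have c\<alpha>: "continuous_on S (\<lambda>x. \<alpha> (k x) (l x))"
    and c\<beta>: "continuous_on S (\<lambda>x. \<beta> (k x) (l x))"
    and cg: "continuous_on S (\<lambda>x. g (k x) (l x))"
    if "continuous_on S k" "continuous_on S l" for S :: "'z::topological_space set" and k l
    unfolding \<alpha>_def \<beta>_def g_def using that
    by (auto intro!: continuous_intros ccomp[OF cp] ccomp[OF cq] ccomp[OF cont(1)] ccomp[OF cont(2)] ccomp[OF cont(3)])
  have ray: "((\<lambda>s. complex_of_real s * w) has_vector_derivative w) (at s within S)" for w and s :: real and S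
    by (auto intro!: derivative_eq_intros)
  have along: "((\<lambda>s. of_real s * f (of_real s * w)) has_vector_derivative
      f (of_real s * w) + of_real s * (f1 (of_real s * w) * w + f2 (of_real s * w) * cnj w)) (at s within S)"
    if "has_wirtinger f f1 f2" for f f1 f2 w and s :: real and S
  proof -
    have "((\<lambda>s. f (of_real s * w)) has_vector_derivative (f1 (of_real s * w) * w + f2 (of_real s * w) * cnj w)) (at s within S)"
      using has_derivative_compose[OF ray[unfolded has_vector_derivative_def] has_wirtingerD[OF that, of "of_real s * w"]]
      by (simp add: has_vector_derivative_def scaleR_conv_of_real algebra_simps)
    from has_vector_derivative_mult[OF has_vector_derivative_of_real[OF DERIV_ident[unfolded has_real_derivative_iff_has_vector_derivative]] this]
    show ?thesis by (simp add: algebra_simps)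
  qed
  have I\<alpha>: "integral (cbox 0 1) (\<lambda>s. \<alpha> s w) = p w" for w
    unfolding \<alpha>_def
    using fundamental_theorem_of_calculus[of 0 1, OF _ along[OF p, of w]]
    by (auto intro!: integral_unique)
  have I\<beta>: "integral (cbox 0 1) (\<lambda>s. \<beta> s w) = q w" for w
    unfolding \<beta>_def
    using fundamental_theorem_of_calculus[of 0 1, OF _ along[OF q, of w]]
    by (auto intro!: integral_unique)
  have int: "(\<lambda>s. \<alpha> s w) integrable_on cbox 0 1" "(\<lambda>s. \<beta> s w) integrable_on cbox 0 1"
    "(\<lambda>s. g s w) integrable_on cbox 0 1" for w
    by (intro integrable_continuous c\<alpha> c\<beta> cg continuous_intros)+
  have cComplex: "continuous_on S (\<lambda>x. Complex (k x) (l x))"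
    if "continuous_on S k" "continuous_on S l" for S :: "'z::topological_space set" and k l
    using that unfolding Complex_eq by (intro continuous_intros)
  define P where "P = (\<lambda>w. integral (cbox 0 1) (\<lambda>s. g s w))"
  have "has_wirtinger P p q"
  proof (rule has_wirtingerI_partials[OF _ _ cp cq])
    fix x y
    have "((\<lambda>x. P (Complex x y)) has_vector_derivative
        integral (cbox 0 1) (\<lambda>s. \<alpha> s (Complex x y) + \<beta> s (Complex x y))) (at x within UNIV)"
      unfolding P_def
      by (rule leibniz_rule_vector_derivative)
         (use has_wirtinger_Complex_left[OF g] int in \<open>auto intro!: continuous_intros c\<alpha> c\<beta> cComplex simp: split_beta\<close>)
    also have "integral (cbox 0 1) (\<lambda>s. \<alpha> s (Complex x y) + \<beta> s (Complex x y)) = p (Complex x y) + q (Complex x y)"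
      by (simp only: integral_add[OF int(1,2)] I\<alpha> I\<beta>)
    finally show "((\<lambda>x. P (Complex x y)) has_vector_derivative p (Complex x y) + q (Complex x y)) (at x)" .
    have "((\<lambda>y. P (Complex x y)) has_vector_derivative
        integral (cbox 0 1) (\<lambda>s. \<i> * (\<alpha> s (Complex x y) - \<beta> s (Complex x y)))) (at y within UNIV)"
      unfolding P_def
      by (rule leibniz_rule_vector_derivative)
         (use has_wirtinger_Complex_right[OF g] int in \<open>auto intro!: continuous_intros c\<alpha> c\<beta> cComplex simp: split_beta\<close>)
    also have "integral (cbox 0 1) (\<lambda>s. \<i> * (\<alpha> s (Complex x y) - \<beta> s (Complex x y))) = \<i> * (p (Complex x y) - q (Complex x y))"
      by (simp only: integral_mult_right integral_diff[OF int(1,2)] I\<alpha> I\<beta>)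
    finally show "((\<lambda>y. P (Complex x y)) has_vector_derivative \<i> * (p (Complex x y) - q (Complex x y))) (at y)" .
  qed
  then show ?thesis by blast
qed

section \<open>Integrals over the circles \<open>Re w = t\<close>\<close>

definition circle_integral :: "(complex \<Rightarrow> complex) \<Rightarrow> real \<Rightarrow> complex" where
  "circle_integral f t = integral {0..2 * pi} (\<lambda>y. f (Complex t y))"

lemma integrable_on_Complex:
  assumes "continuous_on UNIV (f :: complex \<Rightarrow> 'a::euclidean_space)"
  shows "(\<lambda>y. f (Complex t y)) integrable_on {a..b}" "(\<lambda>t. f (Complex t y)) integrable_on {a..b}"
  by (auto intro!: integrable_continuous_real continuous_on_Complex_arg[OF assms] continuous_intros)

lemma Complex_add_two_pi: "Complex t y + 2 * of_real pi * \<i> = Complex t (y + 2 * pi)"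
  by (simp add: complex_eq_iff)

text \<open>The derivative of \<open>f\<close> along the circle is \<open>\<i> * (p - q)\<close> and
  integrates to zero by periodicity, so the two circle integrals agree. The derivative in
  \<open>t\<close> is the integral of \<open>p + q\<close>, hence twice either of them.\<close>

lemma circle_integral_wirtinger:
  assumes f: "has_wirtinger f p q" and per: "\<And>w. f (w + 2 * of_real pi * \<i>) = f w"
    and cont: "continuous_on UNIV p" "continuous_on UNIV q"
  shows "circle_integral p t = circle_integral q t"
    and "(circle_integral f has_vector_derivative 2 * circle_integral p t) (at t within S)"
proof -
  have "((\<lambda>y. \<i> * (p (Complex t y) - q (Complex t y))) has_integral
      (f (Complex t (2 * pi)) - f (Complex t 0))) {0..2*pi}"
    by (rule fundamental_theorem_of_calculus) (auto intro!: has_wirtinger_Complex_right[OF f])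
  moreover have "f (Complex t (2 * pi)) = f (Complex t 0)"
    using per[of "Complex t 0"] by (metis Complex_add_two_pi add.left_neutral)
  ultimately have "integral {0..2*pi} (\<lambda>y. \<i> * (p (Complex t y) - q (Complex t y))) = 0"
    by (simp only: integral_unique diff_self)
  then have "\<i> * (circle_integral p t - circle_integral q t) = 0"
    unfolding circle_integral_def
    by (simp only: integral_mult_right integral_diff integrable_on_Complex(1) cont)
  then show eq: "circle_integral p t = circle_integral q t" by simp
  have "(circle_integral f has_vector_derivative
     integral (cbox 0 (2*pi)) (\<lambda>y. p (Complex t y) + q (Complex t y))) (at t within UNIV)"
    unfolding circle_integral_def[abs_def] cbox_interval[symmetric]
    using has_wirtinger_Complex_left[OF f] cont has_wirtinger_continuous[OF f, of UNIV]
    by (intro leibniz_rule_vector_derivative)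
       (auto intro!: integrable_on_Complex continuous_intros continuous_on_Complex_arg simp: split_beta)
  also have "integral (cbox 0 (2*pi)) (\<lambda>y. p (Complex t y) + q (Complex t y)) = 2 * circle_integral p t"
    using eq unfolding circle_integral_def
    by (simp add: integral_add integrable_on_Complex cont)
  finally show "(circle_integral f has_vector_derivative 2 * circle_integral p t) (at t within S)"
    by (rule has_vector_derivative_within_subset) auto
qed

section \<open>Circle means and area integrals\<close>

lemma periodic_integral:
  fixes F :: "real \<Rightarrow> 'a::euclidean_space"
  assumes cont: "continuous_on UNIV F" and per: "\<And>x. F (x + p) = F x" and p: "p \<ge> 0"
  shows "integral {a..a + p} F = integral {0..p} F"
proof -
  have int: "F integrable_on {x..y}" for x y
    by (rule integrable_continuous_real) (use cont continuous_on_subset in blast)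
  have shift: "integral {x + p..y + p} F = integral {x..y} F" for x y
    using integral_shift[of x p y F] continuous_on_subset[OF cont] per by (simp add: o_def)
  show ?thesis
  proof (cases "a \<ge> 0")
    case True
    have "integral {0..p} F + integral {p..a + p} F = integral {0..a} F + integral {a..a + p} F"
      using True p by (simp add: Henstock_Kurzweil_Integration.integral_combine int)
    with shift[of 0 a] show ?thesis by simp
  next
    case False
    have "integral {a..0} F + integral {0..p} F = integral {a..a+p} F + integral {a+p..p} F"
      using False p by (simp add: Henstock_Kurzweil_Integration.integral_combine int)
    with shift[of a 0] show ?thesis by simp
  qed
qed

text \<open>Two one-dimensional substitutions: \<open>x = r * cos \<theta>\<close> at fixed
  \<theta>, then, after exchanging the integrals, \<open>y = x * tan \<theta>\<close> at fixed
  \<open>x\<close>. In the sector \<bar>\<theta>\<bar> \<le> pi/4 the cosine is positive and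
  \<open>y\<close> stays in \<open>[-x, x]\<close>. As only an upper bound is wanted, both domains
  are enlarged to those of a rectangle.\<close>

lemma sector_integral_le:
  fixes g :: "complex \<Rightarrow> real"
  assumes cont: "continuous_on UNIV g" and nn: "\<And>z. g z \<ge> 0" and \<rho>: "\<rho> > 0"
  shows "integral {-(pi/4)..pi/4} (\<lambda>\<theta>. integral {0..\<rho>} (\<lambda>r. r * g (of_real r * cis \<theta>)))
    \<le> integral {0..\<rho>} (\<lambda>x. integral {-\<rho>..\<rho>} (\<lambda>y. g (Complex x y)))"
proof -
  have cos: "cos \<theta> > 0" if "\<theta> \<in> {-(pi/4)..pi/4}" for \<theta>
    using that pi_gt_zero unfolding atLeastAtMost_iff by (intro cos_gt_zero_pi) linarith+
  \<comment> \<open>The factor \<open>x / (cos \<theta>)\<^sup>2\<close> serves both substitutions: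
    \<open>r dr\<close> becomes \<open>x / (cos \<theta>)\<^sup>2 dx\<close>, and it is also the
    \<theta>-derivative of \<open>x * tan \<theta>\<close>.\<close>
  define k where "k = (\<lambda>\<theta> x. x / (cos \<theta>)\<^sup>2 * g (Complex x (x * tan \<theta>)))"
  note cC = continuous_on_Complex_arg[OF cont]
  have ck: "continuous_on S (\<lambda>z. k (u z) (v z))"
    if "continuous_on S u" "continuous_on S v" "\<And>z. z \<in> S \<Longrightarrow> u z \<in> {-(pi/4)..pi/4}"
    for S :: "'z::t2_space set" and u v
    unfolding k_def tan_def using that(1,2) cos[OF that(3)]
    by (intro continuous_intros cC) force+
  have cgr: "continuous_on S (\<lambda>z. g (of_real (u z) * cis (v z)))"
    if "continuous_on S u" "continuous_on S v"
    for S :: "'z::t2_space set" and u v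
    using that by (intro continuous_on_compose2[OF cont] continuous_intros) auto
  have inner: "integral {0..\<rho>} (\<lambda>r. r * g (of_real r * cis \<theta>)) \<le> integral {0..\<rho>} (k \<theta>)"
    if \<theta>: "\<theta> \<in> {-(pi/4)..pi/4}" for \<theta>
  proof -
    have le: "x * cos \<theta> \<le> \<rho>" if "0 \<le> x" "x \<le> \<rho>" for x
      using mult_mono[OF that(2) cos_le_one[of \<theta>]] that \<rho> cos[OF \<theta>] by simp
    have "((\<lambda>r. cos \<theta> *\<^sub>R k \<theta> (r * cos \<theta>)) has_integral integral {0 * cos \<theta>..\<rho> * cos \<theta>} (k \<theta>)) {0..\<rho>}"
      using \<rho> cos[OF \<theta>] \<theta>
      by (intro has_integral_substitution[where c = 0 and d = \<rho>])
         (auto intro!: derivative_eq_intros ck continuous_intros simp: le)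
    moreover have "cos \<theta> *\<^sub>R k \<theta> (r * cos \<theta>) = r * g (of_real r * cis \<theta>)" for r
      using cos[OF \<theta>] by (simp add: k_def cis.code complex_of_real_mult_Complex tan_def power2_eq_square)
    ultimately have "integral {0..\<rho>} (\<lambda>r. r * g (of_real r * cis \<theta>)) = integral {0..\<rho> * cos \<theta>} (k \<theta>)"
      by (simp add: integral_unique)
    also have "\<dots> \<le> integral {0..\<rho>} (k \<theta>)"
      using \<rho> \<theta> nn cos[OF \<theta>]
      by (intro integral_subset_le integrable_continuous_real ck continuous_intros)
         (auto simp: k_def le)
    finally show ?thesis .
  qed
  have "integral {-(pi/4)..pi/4} (\<lambda>\<theta>. integral {0..\<rho>} (\<lambda>r. r * g (of_real r * cis \<theta>)))
      \<le> integral (cbox (-(pi/4)) (pi/4)) (\<lambda>\<theta>. integral (cbox 0 \<rho>) (k \<theta>))"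
    unfolding cbox_interval
    by (rule integral_le[OF _ _ inner])
       (auto simp: split_beta intro!: integrable_continuous_real ck cgr continuous_intros
          integral_continuous_on_param[of _ 0 \<rho>, unfolded cbox_interval])
  also have "\<dots> = integral (cbox 0 \<rho>) (\<lambda>x. integral (cbox (-(pi/4)) (pi/4)) (\<lambda>\<theta>. k \<theta> x))"
    by (rule integral_swap_continuous) (auto simp: split_beta cbox_Pair_eq intro!: ck continuous_intros)
  also have "\<dots> \<le> integral {0..\<rho>} (\<lambda>x. integral {-\<rho>..\<rho>} (\<lambda>y. g (Complex x y)))"
    unfolding cbox_interval
  proof (rule integral_le)
    fix x assume x: "x \<in> {0..\<rho>}"
    have t: "tan (pi/4) = 1" "tan (-(pi/4)) = -1" by (simp_all add: tan_45 tan_minus)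
    have "((\<lambda>\<theta>. (x / (cos \<theta>)\<^sup>2) *\<^sub>R g (Complex x (x * tan \<theta>))) has_integral
        integral {x * tan (-(pi/4))..x * tan (pi/4)} (\<lambda>y. g (Complex x y))) {-(pi/4)..pi/4}"
    proof (intro has_integral_substitution[where c = "-x" and d = x])
      show "(\<lambda>\<theta>. x * tan \<theta>) ` {-(pi/4)..pi/4} \<subseteq> {-x..x}"
      proof safe
        fix \<theta> assume "\<theta> \<in> {-(pi/4)..pi/4}"
        then have "-(pi/2) < -(pi/4)" "-(pi/4) \<le> \<theta>" "\<theta> \<le> pi/4" "pi/4 < pi/2"
          using pi_gt_zero by auto
        then have "tan (-(pi/4)) \<le> tan \<theta>" "tan \<theta> \<le> tan (pi/4)"
          by (intro tan_mono_le; linarith)+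
        with t have "-1 \<le> tan \<theta>" "tan \<theta> \<le> 1" by auto
        with x have "x * (-1) \<le> x * tan \<theta>" "x * tan \<theta> \<le> x * 1"
          by (intro mult_left_mono; simp)+
        then show "x * tan \<theta> \<in> {-x..x}" by simp
      qed
    qed (use x t cos in \<open>auto intro!: derivative_eq_intros cC continuous_intros simp: divide_simps, (metis less_irrefl)\<close>)
    then have "integral {-(pi/4)..pi/4} (\<lambda>\<theta>. k \<theta> x) = integral {-x..x} (\<lambda>y. g (Complex x y))"
      using t by (simp add: integral_unique k_def)
    also have "\<dots> \<le> integral {-\<rho>..\<rho>} (\<lambda>y. g (Complex x y))"
      using x nn by (intro integral_subset_le integrable_on_Complex cont) auto
    finally show "integral {-(pi/4)..pi/4} (\<lambda>\<theta>. k \<theta> x) \<le> integral {-\<rho>..\<rho>} (\<lambda>y. g (Complex x y))" .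
  qed (auto simp: split_beta intro!: integrable_continuous_real ck cC continuous_intros
      integral_continuous_on_param[of _ "-\<rho>" \<rho>, unfolded cbox_interval]
      integral_continuous_on_param[of _ "-(pi/4)" "pi/4", unfolded cbox_interval])
  finally show ?thesis .
qed


lemma integral_neg_interval:
  fixes f :: "real \<Rightarrow> real"
  shows "integral {-a..a} (\<lambda>x. f (- x)) = integral {-a..a} f"
  by (metis Henstock_Kurzweil_Integration.integral_reflect_real minus_minus)

lemma box_integral_rotate:
  fixes g :: "complex \<Rightarrow> real"
  assumes cont: "continuous_on UNIV g"
  shows "integral {-\<rho>..\<rho>} (\<lambda>x. integral {-\<rho>..\<rho>} (\<lambda>y. g (\<i> * Complex x y)))
    = integral {-\<rho>..\<rho>} (\<lambda>x. integral {-\<rho>..\<rho>} (\<lambda>y. g (Complex x y)))"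
proof -
  have "integral {-\<rho>..\<rho>} (\<lambda>x. integral {-\<rho>..\<rho>} (\<lambda>y. g (\<i> * Complex x y)))
      = integral {-\<rho>..\<rho>} (\<lambda>x. integral {-\<rho>..\<rho>} (\<lambda>y. g (Complex (- y) x)))"
    by (simp add: Complex_eq algebra_simps)
  also have "\<dots> = integral {-\<rho>..\<rho>} (\<lambda>x. integral {-\<rho>..\<rho>} (\<lambda>y. g (Complex y x)))"
    using integral_neg_interval[of \<rho> "\<lambda>y. g (Complex y x)" for x] by simp
  also have "\<dots> = integral {-\<rho>..\<rho>} (\<lambda>y. integral {-\<rho>..\<rho>} (\<lambda>x. g (Complex y x)))"
    unfolding cbox_interval[symmetric]
    by (rule integral_swap_continuous)
       (auto simp: split_beta intro!: continuous_on_Complex_arg cont continuous_intros)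
  finally show ?thesis .
qed

text \<open>Multiplication by powers of \<open>\<i>\<close> carries one sector of angle
  \<open>pi/2\<close> to the four that make up the circle and leaves the integral over the square
  unchanged. Each sector is bounded by the whole square, whence the generous factor
  \<open>4\<close>.\<close>

lemma polar_integral_le:
  fixes g :: "complex \<Rightarrow> real"
  assumes cont: "continuous_on UNIV g" and nn: "\<And>z. g z \<ge> 0" and \<rho>: "\<rho> > 0"
  shows "integral {0..2*pi} (\<lambda>\<theta>. integral {0..\<rho>} (\<lambda>r. r * g (of_real r * cis \<theta>)))
    \<le> 4 * integral {-\<rho>..\<rho>} (\<lambda>x. integral {-\<rho>..\<rho>} (\<lambda>y. g (Complex x y)))"
proof -
  define F where "F = (\<lambda>\<theta>. integral {0..\<rho>} (\<lambda>r. r * g (of_real r * cis \<theta>)))"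
  define B where "B = (\<lambda>g. integral {-\<rho>..\<rho>} (\<lambda>x. integral {-\<rho>..\<rho>} (\<lambda>y. (g (Complex x y) :: real))))"
  have cF: "continuous_on UNIV F"
    unfolding F_def cbox_interval[symmetric]
    by (rule integral_continuous_on_param)
       (auto simp: split_beta intro!: continuous_on_compose2[OF cont] continuous_intros)
  have intF: "F integrable_on {a..b}" for a b
    by (rule integrable_continuous_real) (use cF continuous_on_subset in blast)
  have contk: "continuous_on UNIV (\<lambda>z. g (c * z))" for c
    by (intro continuous_on_compose2[OF cont] continuous_intros) auto
  have Bk: "B (\<lambda>z. g (\<i> ^ k * z)) = B g" for k
  proof (induction k)
    case (Suc k)
    have "B (\<lambda>z. g (\<i> ^ Suc k * z)) = B (\<lambda>z. g (\<i> ^ k * (\<i> * z)))"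
      by (simp add: algebra_simps)
    also have "\<dots> = B (\<lambda>z. g (\<i> ^ k * z))"
      unfolding B_def using box_integral_rotate[OF contk] by simp
    finally show ?case using Suc by simp
  qed simp
  have sector: "integral {-(pi/4) + of_nat k * (pi/2)..-(pi/4) + of_nat k * (pi/2) + pi/2} F \<le> B g" for k
  proof -
    have rot: "F (\<theta> + of_nat k * (pi/2)) = integral {0..\<rho>} (\<lambda>r. r * g (\<i> ^ k * (of_real r * cis \<theta>)))" for \<theta>
    proof -
      have "cis (\<theta> + of_nat k * (pi/2)) = \<i> ^ k * cis \<theta>"
        using Complex.DeMoivre[of "pi/2" k] by (simp only: cis_mult[symmetric] cis_pi_half mult.commute)
      then show ?thesis by (simp add: F_def algebra_simps)
    qed
    have "integral {-(pi/4) + of_nat k * (pi/2)..-(pi/4) + of_nat k * (pi/2) + pi/2} F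
        = integral {-(pi/4)..pi/4} (\<lambda>\<theta>. F (\<theta> + of_nat k * (pi/2)))"
      using integral_shift[of "-(pi/4)" "of_nat k * (pi/2)" "pi/4" F] continuous_on_subset[OF cF]
      by (simp add: o_def algebra_simps)
    also have "\<dots> = integral {-(pi/4)..pi/4} (\<lambda>\<theta>. integral {0..\<rho>} (\<lambda>r. r * g (\<i> ^ k * (of_real r * cis \<theta>))))"
      by (simp only: rot)
    also have "\<dots> \<le> integral {0..\<rho>} (\<lambda>x. integral {-\<rho>..\<rho>} (\<lambda>y. g (\<i> ^ k * Complex x y)))"
      by (rule sector_integral_le[OF contk]) (use nn \<rho> in auto)
    also have "\<dots> \<le> B (\<lambda>z. g (\<i> ^ k * z))"
      unfolding B_def using \<rho> nn
      by (intro integral_subset_le integrable_continuous_real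
          integral_continuous_on_param[of _ "-\<rho>" \<rho>, unfolded cbox_interval])
         (auto simp: split_beta intro!: integral_nonneg integrable_on_Complex continuous_on_Complex_arg[OF contk] contk continuous_intros)
    finally show ?thesis using Bk by simp
  qed
  have "integral {0..2*pi} F = integral {-(pi/4)..-(pi/4) + 2 * pi} F"
  proof (rule periodic_integral[OF cF, symmetric])
    show "F (x + 2 * pi) = F x" for x
      by (simp add: F_def cis.code)
  qed simp
  also have "\<dots> = integral {-(pi/4)..pi/4} F + integral {pi/4..3*pi/4} F + integral {3*pi/4..5*pi/4} F + integral {5*pi/4..7*pi/4} F"
    by (simp add: Henstock_Kurzweil_Integration.integral_combine intF)
  also have "\<dots> \<le> 4 * B g"
    using sector[of 0] sector[of 1] sector[of 2] sector[of 3]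
    by (simp add: algebra_simps)
  finally show ?thesis unfolding F_def B_def .
qed


section \<open>Mean values over circles with arbitrary centre\<close>

definition log_shift :: "complex \<Rightarrow> complex \<Rightarrow> complex" where
  "log_shift c w = c + exp w"

text \<open>The line \<open>Re w = s\<close> wraps onto the circle of radius \<open>exp s\<close>
  about \<open>c\<close>. What is known for functions of period \<open>2 * pi * \<i>\<close> thereby
  applies to circle means about any point, with the centre at \<open>s\<close> tending to minus
  infinity.\<close>

lemma log_shift_Complex: "log_shift c (Complex s y) = c + of_real (exp s) * cis y"
  by (simp add: log_shift_def exp_eq_polar)

lemma log_shift_deriv: "(log_shift c has_field_derivative exp w) (at w)"
  unfolding log_shift_def by (auto intro!: derivative_eq_intros)

lemma circle_integral_norm_le:
  assumes "continuous_on UNIV f" "\<And>y. norm (f (Complex t y)) \<le> K"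
  shows "norm (circle_integral f t) \<le> 2 * pi * K"
proof -
  have "norm (circle_integral f t) \<le> K * (2 * pi - 0)"
    unfolding circle_integral_def
    by (rule integral_bound)
       (auto intro!: continuous_on_Complex_arg assms continuous_intros)
  then show ?thesis by (simp add: mult.commute)
qed

lemma circle_integral_const:
  fixes c :: complex
  shows "circle_integral (\<lambda>w. c) t = 2 * pi * c"
  by (simp add: circle_integral_def scaleR_conv_of_real)

lemma circle_integral_diff:
  assumes "continuous_on UNIV f" "continuous_on UNIV g"
  shows "circle_integral (\<lambda>w. f w - g w) t = circle_integral f t - circle_integral g t"
  unfolding circle_integral_def by (intro integral_diff integrable_on_Complex assms)

lemma circle_integral_shrink:
  fixes f :: "complex \<Rightarrow> complex"
  assumes cont: "continuous_on UNIV f"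
  shows "((\<lambda>s. circle_integral (\<lambda>w. f (log_shift c w)) s) \<longlongrightarrow> 2 * pi * f c) at_bot"
proof (rule tendstoI)
  fix e :: real assume e: "e > 0"
  have cf: "continuous_on UNIV (\<lambda>w. f (log_shift c w))"
    unfolding log_shift_def by (intro continuous_on_compose2[OF cont] continuous_intros) auto
  from e have "e / (4 * pi) > 0" by simp
  with cont obtain d where d: "d > 0" "\<And>z. dist z c < d \<Longrightarrow> dist (f z) (f c) < e / (4 * pi)"
    unfolding continuous_on_iff by (metis UNIV_I)
  have "\<forall>\<^sub>F s in at_bot. exp s < d"
    using d(1) exp_at_bot order_tendstoD(2) by blast
  then show "\<forall>\<^sub>F s in at_bot. dist (circle_integral (\<lambda>w. f (log_shift c w)) s) (2 * pi * f c) < e"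
  proof eventually_elim
    case (elim s)
    have "norm (circle_integral (\<lambda>w. f (log_shift c w) - f c) s) \<le> 2 * pi * (e / (4 * pi))"
    proof (rule circle_integral_norm_le)
      show "continuous_on UNIV (\<lambda>w. f (log_shift c w) - f c)"
        by (intro continuous_intros cf)
      show "norm (f (log_shift c (Complex s y)) - f c) \<le> e / (4 * pi)" for y
        using d(2)[of "log_shift c (Complex s y)"] elim
        by (simp add: log_shift_Complex dist_norm norm_mult)
    qed
    also have "circle_integral (\<lambda>w. f (log_shift c w) - f c) s = circle_integral (\<lambda>w. f (log_shift c w)) s - 2 * pi * f c"
      by (simp add: circle_integral_diff[OF cf] circle_integral_const)
    finally show ?case using e by (simp add: dist_norm)
  qed
qed

text \<open>The composite with \<open>log_shift c\<close> has vanishing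
  \<open>cnj w\<close>-derivative, so its circle integral does not depend on \<open>s\<close>; the
  value is read off as the circles shrink to \<open>c\<close>.\<close>

lemma holomorphic_circle_mean:
  fixes f :: "complex \<Rightarrow> complex"
  assumes hol: "\<And>z. (f has_field_derivative f' z) (at z)"
  shows "circle_integral (\<lambda>w. f (log_shift c w)) s = 2 * pi * f c"
proof -
  let ?M = "circle_integral (\<lambda>w. f (log_shift c w))"
  have fc: "continuous_on UNIV f"
    using hol by (meson DERIV_isCont continuous_at_imp_continuous_on)
  have f'c: "continuous_on UNIV f'"
  proof -
    have "f holomorphic_on UNIV" using hol by (auto simp: holomorphic_on_open)
    then have "deriv f holomorphic_on UNIV" by (simp add: holomorphic_deriv)
    moreover have "deriv f = f'" using hol DERIV_imp_deriv by blast
    ultimately show ?thesis using holomorphic_on_imp_continuous_on by blast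
  qed
  have W: "has_wirtinger (\<lambda>w. f (log_shift c w)) (\<lambda>w. f' (log_shift c w) * exp w) (\<lambda>w. 0)"
    using has_wirtinger_chain_right[OF has_wirtinger_holomorphic[OF hol] log_shift_deriv] by simp
  have "(?M has_vector_derivative 2 * circle_integral (\<lambda>w. f' (log_shift c w) * exp w) t) (at t within UNIV)" for t
    by (rule circle_integral_wirtinger(2)[OF W])
       (auto simp: log_shift_def exp_add exp_two_pi_i mult.commute[of \<i>] intro!: continuous_intros continuous_on_compose2[OF f'c])
  moreover have "circle_integral (\<lambda>w. f' (log_shift c w) * exp w) t = circle_integral (\<lambda>w. 0) t" for t
    by (rule circle_integral_wirtinger(1)[OF W])
       (auto simp: log_shift_def exp_add exp_two_pi_i mult.commute[of \<i>] intro!: continuous_intros continuous_on_compose2[OF f'c])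
  ultimately have "(?M has_vector_derivative 0) (at t within UNIV)" for t
    by (simp add: circle_integral_const)
  then obtain k where k: "\<And>t. ?M t = k"
    using has_vector_derivative_zero_constant[of UNIV ?M] by auto
  with circle_integral_shrink[OF fc, of c] have "k = 2 * pi * f c"
    by (simp add: tendsto_const_iff)
  with k show ?thesis by simp
qed

lemma circle_integral_of_real:
  "circle_integral (\<lambda>w. of_real (v w)) t = of_real (integral {0..2*pi} (\<lambda>y. v (Complex t y)))"
  if "continuous_on UNIV v"
  using integral_linear[OF integrable_on_Complex(1)[OF that] bounded_linear_of_real[where 'a = complex]]
  by (simp add: circle_integral_def o_def)

text \<open>Here \<open>4 * q\<close> is the Laplacian of \<open>v\<close>. In the logarithmic
  coordinate about \<open>c\<close>, the derivative of the circle integral \<open>M\<close> is twice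
  the circle integral of \<open>A\<close>, and the latter is nondecreasing because
  \<open>q \<ge> 0\<close>. It tends to \<open>0\<close> as the circle shrinks, since
  \<open>A\<close> carries the factor \<open>exp w\<close>; so it is nonnegative, and
  \<open>M\<close> increases from its limit \<open>2 * pi * v c\<close>.\<close>

lemma subharmonic_circle_mean:
  fixes v :: "complex \<Rightarrow> real"
  assumes v: "has_wirtinger (\<lambda>w. of_real (v w)) a a'" and a: "has_wirtinger a b (\<lambda>w. of_real (q w))"
    and cont: "continuous_on UNIV b" "continuous_on UNIV q" "continuous_on UNIV a'" and q: "\<And>w. q w \<ge> 0"
  shows "2 * pi * v c \<le> integral {0..2*pi} (\<lambda>y. v (c + of_real (exp s) * cis y))"
proof -
  define A where "A = (\<lambda>w. a (log_shift c w) * exp w)"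
  define M where "M = circle_integral (\<lambda>w. of_real (v (log_shift c w)))"
  have ca: "continuous_on UNIV a" by (rule has_wirtinger_continuous[OF a])
  have cl: "continuous_on UNIV (log_shift c)"
    unfolding log_shift_def by (intro continuous_intros)
  have "continuous_on UNIV (\<lambda>w. Re (of_real (v w)))"
    by (intro continuous_intros has_wirtinger_continuous[OF v])
  then have cv: "continuous_on UNIV v" by simp
  have comp: "continuous_on UNIV (\<lambda>w. f (log_shift c w))" if "continuous_on UNIV f" for f :: "complex \<Rightarrow> 'z::real_normed_vector"
    using continuous_on_compose2[OF that cl] by simp
  have per: "log_shift c (w + 2 * of_real pi * \<i>) = log_shift c w" for w
    by (simp add: log_shift_def exp_add exp_two_pi_i)
  have W1: "has_wirtinger (\<lambda>w. of_real (v (log_shift c w))) A (\<lambda>w. a' (log_shift c w) * cnj (exp w))"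
    unfolding A_def by (rule has_wirtinger_chain_right[OF v log_shift_deriv])
  have ex: "has_wirtinger exp exp (\<lambda>w. 0)"
    by (rule has_wirtinger_holomorphic) (rule DERIV_exp)
  \<comment> \<open>A holomorphic change of variable multiplies the mixed derivative by the squared
    modulus of its derivative, so the sign survives.\<close>
  have W2: "has_wirtinger A (\<lambda>w. b (log_shift c w) * exp w * exp w + a (log_shift c w) * exp w)
      (\<lambda>w. of_real (q (log_shift c w) * (norm (exp w))\<^sup>2))"
    unfolding A_def
    by (rule has_wirtinger_cong[OF has_wirtinger_mult[OF has_wirtinger_chain_right[OF a log_shift_deriv] ex]])
       (auto simp: of_real_mult complex_norm_square mult_ac simp del: norm_exp_eq_Re of_real_power)
  have cA: "continuous_on UNIV A" by (rule has_wirtinger_continuous[OF W2])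
  have dM: "(M has_vector_derivative 2 * circle_integral A t) (at t within S)" for t S
    unfolding M_def
    by (rule circle_integral_wirtinger(2)[OF W1]) (use cA comp[OF cont(3)] in \<open>auto simp: per intro!: continuous_intros\<close>)
  have cq: "continuous_on UNIV (\<lambda>w. q (log_shift c w) * (norm (exp w))\<^sup>2)"
    by (intro continuous_intros comp cont)
  have cR: "continuous_on UNIV (\<lambda>w. b (log_shift c w) * exp w * exp w + a (log_shift c w) * exp w)"
    by (intro continuous_intros comp cont ca)
  have perA: "A (w + 2 * of_real pi * \<i>) = A w" for w
    unfolding A_def per by (simp add: exp_add exp_two_pi_i)
  define Q where "Q = (\<lambda>t. integral {0..2*pi} (\<lambda>y. q (log_shift c (Complex t y)) * (norm (exp (Complex t y)))\<^sup>2))"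
  have dA: "(circle_integral A has_vector_derivative of_real (2 * Q t)) (at t within S)" for t S
  proof -
    have "circle_integral (\<lambda>w. of_real (q (log_shift c w) * (norm (exp w))\<^sup>2)) t = of_real (Q t)"
      by (simp only: circle_integral_of_real[OF cq] Q_def)
    with circle_integral_wirtinger[OF W2 perA cR continuous_on_of_real[OF cq], of t]
    show ?thesis by (simp only: of_real_mult of_real_numeral)
  qed
  have Q: "Q t \<ge> 0" for t
    unfolding Q_def by (intro integral_nonneg integrable_on_Complex[OF cq]) (auto intro!: mult_nonneg_nonneg q)
  have dRe: "((\<lambda>t. Re (F t)) has_real_derivative Re D) (at t)" if "(F has_vector_derivative D) (at t)" for F D t
    using bounded_linear.has_vector_derivative[OF bounded_linear_Re that]
    by (simp add: has_real_derivative_iff_has_vector_derivative)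
  have mono: "Re (circle_integral A s) \<le> Re (circle_integral A t)" if "s \<le> t" for s t
    by (rule DERIV_nonneg_imp_nondecreasing[OF that])
       (metis dRe[OF dA] Re_complex_of_real Q mult_nonneg_nonneg zero_le_numeral)
  obtain K where K: "\<And>z. z \<in> cball c 1 \<Longrightarrow> norm (a z) \<le> K"
    using compact_continuous_image[OF continuous_on_subset[OF ca subset_UNIV] compact_cball[of c 1]]
    by (metis bounded_iff compact_imp_bounded imageI)
  have small: "norm (circle_integral A t) \<le> 2 * pi * (K * exp t)" if "t \<le> 0" for t
  proof (rule circle_integral_norm_le[OF cA])
    show "norm (A (Complex t y)) \<le> K * exp t" for y
      using K[of "log_shift c (Complex t y)"] that
      by (auto simp: A_def norm_mult log_shift_Complex dist_norm intro!: mult_right_mono)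
  qed
  have lim: "((\<lambda>t. - (2 * pi * (K * exp t))) \<longlongrightarrow> - (2 * pi * (K * 0))) at_bot"
    by (intro tendsto_intros exp_at_bot)
  have pos: "Re (circle_integral A t) \<ge> 0" for t
  proof -
    have "\<forall>\<^sub>F s in at_bot. - (2 * pi * (K * exp s)) \<le> Re (circle_integral A t)"
      using eventually_le_at_bot[of "min t 0"]
    proof eventually_elim
      case (elim s)
      have "- norm (circle_integral A s) \<le> Re (circle_integral A s)"
        using abs_Re_le_cmod[of "circle_integral A s"] by linarith
      with small[of s] mono[of s t] elim show ?case by linarith
    qed
    from tendsto_upperbound[OF lim this] show ?thesis by simp
  qed
  have monoM: "Re (M s) \<le> Re (M t)" if "s \<le> t" for s t
    by (rule DERIV_nonneg_imp_nondecreasing[OF that])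
       (use dRe[OF dM] pos in \<open>auto intro!: exI\<close>)
  have "((\<lambda>t. Re (M t)) \<longlongrightarrow> Re (of_real (2 * pi) * of_real (v c))) at_bot"
    unfolding M_def
    by (intro tendsto_Re circle_integral_shrink has_wirtinger_continuous[OF v])
  moreover have "\<forall>\<^sub>F t in at_bot. Re (M t) \<le> Re (M s)"
    using eventually_le_at_bot[of s] by eventually_elim (rule monoM)
  ultimately have "2 * pi * v c \<le> Re (M s)"
    using tendsto_upperbound[of "\<lambda>t. Re (M t)" "Re (of_real (2 * pi) * of_real (v c))" at_bot] by simp
  also have "Re (M s) = integral {0..2*pi} (\<lambda>y. v (c + of_real (exp s) * cis y))"
    unfolding M_def by (simp add: circle_integral_of_real[OF comp[OF cv]] log_shift_Complex)
  finally show ?thesis .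
qed

text \<open>Integrating the circle hypothesis against \<open>r dr\<close> over radii up to
  \<open>1\<close> bounds \<open>pi * k\<close> by the integral over the unit disc about
  \<open>c\<close>. \<open>polar_integral_le\<close> replaces the disc by a square of side
  \<open>2\<close>, which is lower than a period and so is covered by one period of each
  circle.\<close>

lemma circle_to_strip_bound:
  fixes g :: "complex \<Rightarrow> real"
  assumes cont: "continuous_on UNIV g" and nn: "\<And>z. g z \<ge> 0"
    and per: "\<And>w. g (w + 2 * of_real pi * \<i>) = g w"
    and circle: "\<And>s. 2 * pi * k \<le> integral {0..2*pi} (\<lambda>y. g (c + of_real (exp s) * cis y))"
  shows "pi * k \<le> 4 * integral {Re c - 1..Re c + 1} (\<lambda>t. integral {0..2*pi} (\<lambda>y. g (Complex t y)))"
proof -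
  have cg: "continuous_on UNIV (\<lambda>z. g (c + z))"
    by (intro continuous_on_compose2[OF cont] continuous_intros) auto
  have cgr: "continuous_on S (\<lambda>z. g (c + of_real (u z) * cis (v z)))"
    if "continuous_on S u" "continuous_on S v"
    for S :: "'z::t2_space set" and u v
    using that by (intro continuous_on_compose2[OF cont] continuous_intros) auto
  have "pi * k = integral {0..1} (\<lambda>r. r * (2 * pi * k))"
    using ident_has_integral[of 0 "1::real"] by (simp add: integral_unique)
  also have "\<dots> \<le> integral {0..1} (\<lambda>r. integral {0..2*pi} (\<lambda>y. r * g (c + of_real r * cis y)))"
  proof (rule integral_le)
    fix r :: real assume r: "r \<in> {0..1}"
    show "r * (2 * pi * k) \<le> integral {0..2*pi} (\<lambda>y. r * g (c + of_real r * cis y))"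
    proof (cases "r = 0")
      case False
      with r have "exp (ln r) = r" "r > 0" by auto
      with circle[of "ln r"] show ?thesis by simp
    qed simp
  qed (auto intro!: integrable_continuous_real integral_continuous_on_param[of _ 0 "2*pi", unfolded cbox_interval] cgr continuous_intros simp: split_beta)
  also have "\<dots> = integral {0..2*pi} (\<lambda>y. integral {0..1} (\<lambda>r. r * g (c + of_real r * cis y)))"
    unfolding cbox_interval[symmetric]
    by (rule integral_swap_continuous) (auto simp: split_beta intro!: cgr continuous_intros)
  also have "\<dots> \<le> 4 * integral {-1..1} (\<lambda>x. integral {-1..1} (\<lambda>y. g (c + Complex x y)))"
    by (rule polar_integral_le[OF cg]) (use nn in auto)
  also have "integral {-1..1} (\<lambda>x. integral {-1..1} (\<lambda>y. g (c + Complex x y)))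
      \<le> integral {-1..1} (\<lambda>x. integral {0..2*pi} (\<lambda>y. g (Complex (Re c + x) y)))"
  proof (rule integral_le)
    fix x
    let ?G = "\<lambda>y. g (Complex (Re c + x) y)"
    have cG: "continuous_on S ?G" for S
      by (intro continuous_on_Complex_arg[OF cont] continuous_intros)
    have "integral {-1..1} (\<lambda>y. g (c + Complex x y)) = integral {-1..1} (\<lambda>y. ?G (y + Im c))"
      by (rule integral_cong) (auto intro!: arg_cong[of _ _ g] simp: complex_eq_iff)
    also have "\<dots> = integral {-1 + Im c..1 + Im c} ?G"
      using integral_shift[of "-1" "Im c" 1 ?G] cG by (simp add: o_def)
    \<comment> \<open>The interval of half-length \<open>1\<close> about \<open>Im c\<close> lies in
      the period interval of half-length \<open>pi\<close>.\<close>
    also have "\<dots> \<le> integral {Im c - pi..(Im c - pi) + 2 * pi} ?G"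
      using pi_gt3 nn by (intro integral_subset_le integrable_on_Complex cont) auto
    also have "\<dots> = integral {0..2*pi} ?G"
      using per[of "Complex (Re c + x) y" for y]
      by (intro periodic_integral cG) (auto simp: Complex_add_two_pi)
    finally show "integral {-1..1} (\<lambda>y. g (c + Complex x y)) \<le> integral {0..2*pi} ?G" .
  qed (auto simp: split_beta intro!: integrable_continuous_real continuous_on_compose2[OF cont] continuous_on_Complex_arg[OF cont] continuous_on_Complex_arg[OF cg] continuous_intros
      integral_continuous_on_param[of _ 0 "2*pi", unfolded cbox_interval]
      integral_continuous_on_param[of _ "-1::real" 1, unfolded cbox_interval])
  also have "integral {-1..1} (\<lambda>x. integral {0..2*pi} (\<lambda>y. g (Complex (Re c + x) y)))
     = integral {Re c - 1..Re c + 1} (\<lambda>t. integral {0..2*pi} (\<lambda>y. g (Complex t y)))"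
  proof -
    have "continuous_on {-1 + Re c..1 + Re c} (\<lambda>t. integral {0..2*pi} (\<lambda>y. g (Complex t y)))"
      by (auto simp: split_beta intro!: continuous_on_Complex_arg[OF cont] continuous_intros
      integral_continuous_on_param[of _ 0 "2*pi", unfolded cbox_interval])
    from integral_shift[OF this] show ?thesis by (simp add: o_def add.commute)
  qed
  finally show ?thesis by simp
qed

section \<open>Periodic entire functions of exponential growth\<close>

text \<open>The operator \<open>(d/dt)\<^sup>2 - \<kappa>\<^sup>2\<close> factors as
  \<open>(d/dt - \<kappa>) (d/dt + \<kappa>)\<close>; the monotone quantities \<open>G\<close> and
  \<open>F\<close> integrate one factor each. The initial conditions make \<open>G s\<close>
  positive, and with it the leading coefficient.\<close>

lemma exp_growth_of_convex:
  fixes z z1 x :: "real \<Rightarrow> real"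
  assumes dz: "\<And>t. t \<ge> s \<Longrightarrow> (z has_real_derivative z1 t) (at t)"
    and dz1: "\<And>t. t \<ge> s \<Longrightarrow> (z1 has_real_derivative x t) (at t)"
    and x: "\<And>t. t \<ge> s \<Longrightarrow> x t \<ge> \<kappa>\<^sup>2 * z t"
    and \<kappa>: "\<kappa> > 0" and init: "z s > 0" "z1 s \<ge> 0"
  shows "\<exists>c d. c > 0 \<and> (\<forall>t\<ge>s. z t \<ge> c * exp (\<kappa> * t) + d * exp (- \<kappa> * t))"
proof -
  define G where "G = (\<lambda>t. (z1 t + \<kappa> * z t) * exp (- \<kappa> * t))"
  define c where "c = G s"
  have "c > 0" using init \<kappa> by (simp add: c_def G_def add_nonneg_pos)
  have Gge: "G t \<ge> c" if "t \<ge> s" for t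
    unfolding c_def
  proof (rule DERIV_nonneg_imp_nondecreasing[OF that])
    fix r assume r: "s \<le> r" "r \<le> t"
    have "(G has_real_derivative (x r - \<kappa>\<^sup>2 * z r) * exp (- \<kappa> * r)) (at r)"
      unfolding G_def using dz[OF r(1)] dz1[OF r(1)]
      by (auto intro!: derivative_eq_intros simp: algebra_simps power2_eq_square)
    moreover have "(x r - \<kappa>\<^sup>2 * z r) * exp (- \<kappa> * r) \<ge> 0" using x[OF r(1)] by simp
    ultimately show "\<exists>y. (G has_real_derivative y) (at r) \<and> 0 \<le> y" by blast
  qed
  define F where "F = (\<lambda>t. z t * exp (\<kappa> * t) - c / (2 * \<kappa>) * exp (2 * \<kappa> * t))"
  have Fge: "F t \<ge> F s" if "t \<ge> s" for t
  proof (rule DERIV_nonneg_imp_nondecreasing[OF that])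
    fix r assume r: "s \<le> r" "r \<le> t"
    have "(F has_real_derivative (z1 r + \<kappa> * z r) * exp (\<kappa> * r) - c * exp (2 * \<kappa> * r)) (at r)"
      unfolding F_def using dz[OF r(1)] \<kappa>
      by (auto intro!: derivative_eq_intros simp: algebra_simps)
    moreover have "(z1 r + \<kappa> * z r) * exp (\<kappa> * r) = G r * exp (2 * \<kappa> * r)"
      unfolding G_def by (simp add: mult.assoc flip: exp_add)
    moreover have "G r * exp (2 * \<kappa> * r) \<ge> c * exp (2 * \<kappa> * r)"
      using Gge[OF r(1)] by simp
    ultimately show "\<exists>y. (F has_real_derivative y) (at r) \<and> 0 \<le> y" by force
  qed
  have "z t \<ge> c / (2 * \<kappa>) * exp (\<kappa> * t) + F s * exp (- \<kappa> * t)" if "t \<ge> s" for t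
  proof -
    have "F s * exp (- \<kappa> * t) \<le> F t * exp (- \<kappa> * t)" using Fge[OF that] by simp
    also have "\<dots> = z t - c / (2 * \<kappa>) * exp (\<kappa> * t)"
      unfolding F_def by (simp add: algebra_simps flip: exp_add)
    finally show ?thesis by simp
  qed
  moreover have "c / (2 * \<kappa>) > 0" using \<open>c > 0\<close> \<kappa> by simp
  ultimately show ?thesis by blast
qed

text \<open>Makes \<open>T\<close> a function of \<open>exp w\<close>, so that any branch of the
  logarithm may be inserted.\<close>

lemma periodic_entire_exp_eq:
  fixes T :: "complex \<Rightarrow> 'a"
  assumes per: "\<And>w. T (w + 2 * of_real pi * \<i>) = T w" and "exp v = exp w"
  shows "T v = T w"
proof -
  have nat: "T (w + of_nat n * (2 * of_real pi * \<i>)) = T w" for w n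
  proof (induction n)
    case (Suc n)
    have "w + of_nat (Suc n) * (2 * of_real pi * \<i>) = (w + of_nat n * (2 * of_real pi * \<i>)) + 2 * of_real pi * \<i>"
      by (simp add: algebra_simps)
    with Suc show ?case by (simp only: per)
  qed simp
  from assms(2) obtain n :: int where n: "v = w + (of_int (2 * n) * pi) * \<i>"
    by (auto simp: exp_eq)
  show ?thesis
  proof (cases "n \<ge> 0")
    case True
    then have "v = w + of_nat (nat n) * (2 * of_real pi * \<i>)" using n by (simp add: algebra_simps)
    then show ?thesis using nat by simp
  next
    case False
    then have "w = v + of_nat (nat (-n)) * (2 * of_real pi * \<i>)" using n by (simp add: algebra_simps)
    then show ?thesis using nat by metis
  qed
qed

text \<open>\<open>S\<close> is \<open>z ^ N * T (log z)\<close> on the punctured plane. The growth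
  bound makes it bounded near \<open>0\<close>, so the singularity is removable, and of order at
  most \<open>2 * N\<close> at infinity, so the extension is a polynomial.\<close>

lemma periodic_entire_laurent_polynomial:
  assumes hol: "T holomorphic_on UNIV"
    and per: "\<And>w. T (w + 2 * of_real pi * \<i>) = T w"
    and growth: "\<And>w. norm (T w) \<le> K * exp (of_nat N * \<bar>Re w\<bar>)"
  shows "\<exists>c. \<forall>w. T w * exp w ^ N = (\<Sum>k\<le>2 * N. c k * exp w ^ k)"
proof -
  define S where "S = (\<lambda>z. z ^ N * T (Ln z))"
  have S_exp: "S (exp w) = exp w ^ N * T w" for w
    unfolding S_def using periodic_entire_exp_eq[of T "Ln (exp w)" w, OF per] by simp
  have Tc: "(\<lambda>z. T (f z)) holomorphic_on X" if "f holomorphic_on X" for f X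
    using holomorphic_on_compose_gen[OF that hol] by (simp add: o_def)
  have "S holomorphic_on UNIV - {0}"
  proof -
    have 1: "S holomorphic_on - \<real>\<^sub>\<le>\<^sub>0"
      unfolding S_def by (intro holomorphic_intros Tc) auto
    \<comment> \<open>\<open>Ln (- z) + \<i> * pi\<close> is a logarithm with its cut on the
      nonnegative axis; the two slit planes together cover the punctured plane.\<close>
    have 2: "S holomorphic_on - \<real>\<^sub>\<ge>\<^sub>0"
    proof (rule holomorphic_transform)
      show "(\<lambda>z. z ^ N * T (Ln (- z) + \<i> * pi)) holomorphic_on - \<real>\<^sub>\<ge>\<^sub>0"
        by (intro holomorphic_intros Tc) (auto simp: complex_nonneg_Reals_iff complex_nonpos_Reals_iff)
      fix z :: complex assume "z \<in> - \<real>\<^sub>\<ge>\<^sub>0"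
      then have "z \<noteq> 0" by auto
      then have "exp (Ln (- z) + \<i> * pi) = exp (Ln z)" by (simp add: exp_add)
      from periodic_entire_exp_eq[of T, OF per this]
      show "z ^ N * T (Ln (- z) + \<i> * pi) = S z" by (simp add: S_def)
    qed
    have "S holomorphic_on (- \<real>\<^sub>\<le>\<^sub>0) \<union> (- \<real>\<^sub>\<ge>\<^sub>0)"
      using 1 2 by (rule holomorphic_on_Un) (auto simp: open_Compl)
    moreover have "UNIV - {0} \<subseteq> (- \<real>\<^sub>\<le>\<^sub>0) \<union> (- \<real>\<^sub>\<ge>\<^sub>0 :: complex set)"
      by (auto simp: complex_nonneg_Reals_iff complex_nonpos_Reals_iff complex_eq_iff)
    ultimately show ?thesis by (rule holomorphic_on_subset)
  qed
  have S_le: "norm (S z) \<le> K * (norm z ^ N * exp (of_nat N * \<bar>ln (norm z)\<bar>))" if "z \<noteq> 0" for z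
    using mult_left_mono[OF growth[of "Ln z"], of "norm z ^ N"] that
    by (simp add: S_def norm_mult norm_power mult_ac)
  have small: "norm (S z) \<le> K" if "z \<noteq> 0" "norm z \<le> 1" for z
  proof -
    have "exp (of_nat N * \<bar>ln (norm z)\<bar>) = inverse (norm z) ^ N"
      using that by (simp add: abs_of_nonpos ln_le_zero_iff exp_of_nat_mult exp_minus power_inverse del: mult_minus_right)
    with S_le[OF that(1)] that show ?thesis by (simp add: power_inverse)
  qed
  have large: "norm (S z) \<le> K * norm z ^ (2 * N)" if "norm z \<ge> 1" for z
  proof -
    have "exp (ln (norm z)) = norm z" using that by (intro exp_ln) linarith
    then have "exp (of_nat N * \<bar>ln (norm z)\<bar>) = norm z ^ N"
      using that by (simp add: exp_of_nat_mult)
    moreover from that have "z \<noteq> 0" by auto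
    ultimately show ?thesis using S_le[of z] by (simp add: mult_2 power_add)
  qed
  have "\<forall>\<^sub>F z in at 0. norm (S z) \<le> K"
    unfolding eventually_at by (intro exI[of _ 1]) (auto intro!: small)
  with \<open>S holomorphic_on UNIV - {0}\<close> obtain g where g: "g holomorphic_on UNIV" "\<And>z. z \<noteq> 0 \<Longrightarrow> g z = S z"
    using holomorphic_on_extend_bounded[of S UNIV 0] by (auto simp: )
  have "norm (g z) \<le> K * norm z ^ (2 * N)" if "1 \<le> norm z" for z
    using large[OF that] g(2)[of z] that by (cases "z = 0") simp_all
  from Liouville_polynomial[OF g(1) this]
  have "g z = (\<Sum>k\<le>2 * N. (deriv ^^ k) g 0 / fact k * z ^ k)" for z by blast
  then have "T w * exp w ^ N = (\<Sum>k\<le>2 * N. (deriv ^^ k) g 0 / fact k * exp w ^ k)" for w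
    using g(2)[of "exp w"] S_exp[of w] by (simp add: mult.commute)
  then show ?thesis by (intro exI[of _ "\<lambda>k. (deriv ^^ k) g 0 / fact k"]) simp
qed

text \<open>A Laurent polynomial in \<open>exp w\<close> is, for \<open>Re w \<ge> 0\<close>, a
  bounded part \<open>lo\<close> plus a polynomial \<open>hi\<close> in \<open>exp w\<close> without
  constant term. Either \<open>hi\<close> vanishes, or it tends to infinity uniformly in
  \<open>Im w\<close>.\<close>

lemma periodic_entire_dichotomy:
  assumes hol: "T holomorphic_on UNIV"
    and per: "\<And>w. T (w + 2 * of_real pi * \<i>) = T w"
    and growth: "\<And>w. norm (T w) \<le> K * exp (of_nat N * \<bar>Re w\<bar>)"
  shows "(\<exists>B. \<forall>w. Re w \<ge> 0 \<longrightarrow> norm (T w) \<le> B) \<or>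
         (\<forall>m. \<exists>s. \<forall>w. Re w \<ge> s \<longrightarrow> norm (T w) \<ge> m)"
proof -
  obtain c where c: "\<And>w. T w * exp w ^ N = (\<Sum>k\<le>2 * N. c k * exp w ^ k)"
    using periodic_entire_laurent_polynomial[OF hol per growth] by blast
  define lo where "lo = (\<lambda>w. \<Sum>k\<le>N. c k * exp w ^ k / exp w ^ N)"
  \<comment> \<open>The constant term is left to \<open>lo\<close>, so that a nonzero
    \<open>hi\<close> is nonconstant.\<close>
  define d where "d = (\<lambda>j. if j = 0 then 0 else c (N + j))"
  define hi where "hi = (\<lambda>z::complex. \<Sum>j\<le>N. d j * z ^ j)"
  have T: "T w = lo w + hi (exp w)" for w
  proof -
    have "T w = (\<Sum>k\<le>N + N. c k * exp w ^ k / exp w ^ N)"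
      using c[of w] by (simp add: sum_divide_distrib[symmetric] eq_divide_eq mult_2)
    also have "\<dots> = lo w + (\<Sum>k = N + 1..N + N. c k * exp w ^ k / exp w ^ N)"
      unfolding lo_def by (subst sum_up_index_split) simp
    also have "(\<Sum>k = N + 1..N + N. c k * exp w ^ k / exp w ^ N) = (\<Sum>j = 1..N. c (N + j) * exp w ^ j)"
      by (rule sum.reindex_bij_witness[of _ "\<lambda>j. N + j" "\<lambda>k. k - N"]) (auto simp: power_diff)
    also have "\<dots> = (\<Sum>j = 1..N. d j * exp w ^ j)"
      by (rule sum.cong) (auto simp: d_def)
    also have "\<dots> = hi (exp w)"
      unfolding hi_def by (rule sum.mono_neutral_left) (auto simp: d_def)
    finally show ?thesis .
  qed
  have lo_le: "norm (lo w) \<le> (\<Sum>k\<le>N. norm (c k))" if "Re w \<ge> 0" for w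
    unfolding lo_def
  proof (intro order_trans[OF norm_sum] sum_mono)
    fix k assume "k \<in> {..N}"
    then have "exp (Re w) ^ k \<le> exp (Re w) ^ N"
      using that by (intro power_increasing) auto
    then show "norm (c k * exp w ^ k / exp w ^ N) \<le> norm (c k)"
      by (simp add: norm_mult norm_divide norm_power divide_le_eq mult_left_mono)
  qed
  show ?thesis
  proof (cases "\<forall>j\<le>N. j \<noteq> 0 \<longrightarrow> d j = 0")
    case True
    then have "hi z = 0" for z unfolding hi_def by (intro sum.neutral) (auto simp: d_def)
    with T have "\<forall>w. Re w \<ge> 0 \<longrightarrow> norm (T w) \<le> (\<Sum>k\<le>N. norm (c k))" using lo_le by simp
    then show ?thesis by blast
  next
    case False
    then obtain j where j: "d j \<noteq> 0" "j \<noteq> 0" "j \<le> N" by auto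
    have "\<exists>s. \<forall>w. Re w \<ge> s \<longrightarrow> norm (T w) \<ge> m" for m
    proof -
      define B where "B = m + (\<Sum>k\<le>N. norm (c k))"
      have "\<forall>\<^sub>F z in at_infinity. B \<le> norm (hi z)"
        unfolding hi_def using polyfun_extremal[where c = d] j by blast
      then obtain b where b: "\<And>z. norm z \<ge> b \<Longrightarrow> B \<le> norm (hi z)"
        unfolding eventually_at_infinity by blast
      show ?thesis
      proof (intro exI allI impI)
        fix w assume w: "Re w \<ge> max 0 b"
        then have "norm (exp w) \<ge> b" using exp_ge_add_one_self[of "Re w"] unfolding norm_exp_eq_Re by linarith
        then have "B \<le> norm (hi (exp w))" by (rule b)
        also have "\<dots> \<le> norm (T w) + norm (lo w)"
          using norm_triangle_ineq4[of "T w" "lo w"] by (simp add: T)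
        finally show "norm (T w) \<ge> m" using lo_le[of w] w by (simp add: B_def)
      qed
    qed
    then show ?thesis by blast
  qed
qed

section \<open>Bounds for solutions on the periodic plane\<close>

text \<open>\<open>a\<close> and \<open>b\<close> are the first and second
  \<open>w\<close>-derivatives of \<open>u\<close>. The slot \<open>cnj (a w)\<close> records that
  \<open>u\<close> is real. The Laplacian is four times the mixed derivative, so
  \<open>- (exp (2 * u w) / 4)\<close> encodes the equation. \<open>b\<close> is only assumed
  continuous because \<open>u\<close> is only of class C2.\<close>

locale liouville_cylinder =
  fixes u :: "complex \<Rightarrow> real" and a b :: "complex \<Rightarrow> complex" and area :: real
  assumes wirtinger_u: "has_wirtinger (\<lambda>w. of_real (u w)) a (\<lambda>w. cnj (a w))"
    and wirtinger_a: "has_wirtinger a b (\<lambda>w. of_real (- (exp (2 * u w) / 4)))"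
    and cont_b: "continuous_on UNIV b"
    and periodic_u: "u (w + 2 * of_real pi * \<i>) = u w"
    and area_le: "R \<ge> 0 \<Longrightarrow> integral {-R..R} (\<lambda>t. integral {0..2*pi} (\<lambda>y. exp (2 * u (Complex t y)))) \<le> area"
begin

lemma cont_a: "continuous_on S a"
  by (rule has_wirtinger_continuous[OF wirtinger_a])

lemma cont_u: "continuous_on S u"
proof -
  have "continuous_on S (\<lambda>w. Re (of_real (u w)))"
    by (intro continuous_intros has_wirtinger_continuous[OF wirtinger_u])
  then show ?thesis by simp
qed

lemma periodic_a: "a (w + 2 * of_real pi * \<i>) = a w"
  by (rule has_wirtinger_periodic(1)[OF wirtinger_u]) (simp add: periodic_u)

lemma periodic_b: "b (w + 2 * of_real pi * \<i>) = b w"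
  by (rule has_wirtinger_periodic(1)[OF wirtinger_a]) (simp add: periodic_a)

text \<open>Negation of \<open>w\<close> exchanges the two ends of the cylinder, so that estimates
  at the right end carry over to the left one.\<close>

lemma reflect: "liouville_cylinder (\<lambda>w. u (- w)) (\<lambda>w. - a (- w)) (\<lambda>w. b (- w)) area"
proof
  have D: "((\<lambda>w. - w) has_field_derivative - 1) (at w)" for w :: complex
    by (auto intro!: derivative_eq_intros)
  show "has_wirtinger (\<lambda>w. of_real (u (- w))) (\<lambda>w. - a (- w)) (\<lambda>w. cnj (- a (- w)))"
    using has_wirtinger_chain_right[OF wirtinger_u D] by simp
  show "has_wirtinger (\<lambda>w. - a (- w)) (\<lambda>w. b (- w)) (\<lambda>w. of_real (- (exp (2 * u (- w)) / 4)))"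
    using has_wirtinger_cmult[OF has_wirtinger_chain_right[OF wirtinger_a D], of "-1"] by simp
  show "continuous_on UNIV (\<lambda>w. b (- w))"
    by (intro continuous_on_compose2[OF cont_b] continuous_intros) auto
  show "u (- (w + 2 * of_real pi * \<i>)) = u (- w)" for w
    using periodic_u[of "- (w + 2 * of_real pi * \<i>)"] by simp
  fix R :: real assume R: "R \<ge> 0"
  define E where "E = (\<lambda>t. integral {0..2*pi} (\<lambda>y. exp (2 * u (Complex t y))))"
  have "integral {0..2*pi} (\<lambda>y. exp (2 * u (- Complex t y))) = E (- t)" for t
  proof -
    let ?F = "\<lambda>y. exp (2 * u (Complex (-t) y))"
    have cF: "continuous_on UNIV ?F"
      by (intro continuous_intros continuous_on_Complex_arg cont_u)
    have "integral {0..2*pi} (\<lambda>y. exp (2 * u (- Complex t y))) = integral {0..2*pi} (\<lambda>y. ?F (- y))"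
    proof -
      have "- Complex t y = Complex (- t) (- y)" for y by (simp add: complex_eq_iff)
      then show ?thesis by simp
    qed
    also have "\<dots> = integral {-(2*pi)..0} ?F"
      using Henstock_Kurzweil_Integration.integral_reflect_real[of "2*pi" 0 "\<lambda>y. ?F (- y)"] by simp
    also have "\<dots> = integral {0..2*pi} ?F"
      using periodic_integral[OF cF, of "2*pi" "-(2*pi)"] periodic_u by (simp flip: Complex_add_two_pi)
    finally show ?thesis by (simp add: E_def)
  qed
  then have "integral {-R..R} (\<lambda>t. integral {0..2*pi} (\<lambda>y. exp (2 * u (- Complex t y)))) = integral {-R..R} (\<lambda>t. E (- t))"
    by simp
  also have "\<dots> = integral {-R..R} E" by (rule integral_neg_interval)
  also have "\<dots> \<le> area" unfolding E_def by (rule area_le[OF R])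
  finally show "integral {-R..R} (\<lambda>t. integral {0..2*pi} (\<lambda>y. exp (2 * u (- Complex t y)))) \<le> area" .
qed

definition E :: "real \<Rightarrow> real" where
  "E t = integral {0..2*pi} (\<lambda>y. exp (2 * u (Complex t y)))"

lemma cont_circle:
  fixes f :: "complex \<Rightarrow> real"
  assumes "continuous_on UNIV f"
  shows "continuous_on S (\<lambda>t. integral {0..2*pi} (\<lambda>y. f (Complex t y)))"
  unfolding cbox_interval[symmetric]
  by (rule integral_continuous_on_param)
     (auto simp: split_beta intro!: continuous_on_Complex_arg assms continuous_intros)

lemma integrable_circle:
  fixes f :: "complex \<Rightarrow> real"
  assumes "continuous_on UNIV f"
  shows "(\<lambda>t. integral {0..2*pi} (\<lambda>y. f (Complex t y))) integrable_on {s..t}"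
  by (intro integrable_continuous_real cont_circle assms)

lemma cont_exp_u: "continuous_on S (\<lambda>w. exp (k * u w))"
  by (intro continuous_intros cont_u)

lemma E_nonneg: "E t \<ge> 0"
  unfolding E_def by (intro integral_nonneg integrable_on_Complex cont_exp_u) auto

lemma E_integrable: "E integrable_on {s..t}"
  using integrable_circle[OF cont_exp_u] unfolding E_def by simp

lemma E_integral: "0 \<le> integral {s..t} E" "integral {s..t} E \<le> area"
proof -
  define R where "R = max \<bar>s\<bar> \<bar>t\<bar>"
  show "0 \<le> integral {s..t} E" by (intro integral_nonneg E_integrable E_nonneg)
  have "integral {s..t} E \<le> integral {-R..R} E"
    by (intro integral_subset_le E_integrable) (auto simp: R_def E_nonneg)
  also have "\<dots> \<le> area" using area_le[of R] by (simp add: E_def[abs_def] R_def)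
  finally show "integral {s..t} E \<le> area" .
qed

lemma area_nonneg: "area \<ge> 0"
  using E_integral[of 0 0] by linarith

text \<open>The circle integral \<open>L\<close> of \<open>u\<close> satisfies
  \<open>L'' = - E\<close>. Hence \<open>L'\<close> varies by at most \<open>area\<close> in all and
  is bounded, and \<open>L\<close> grows at most linearly in either direction.\<close>

lemma mean_u_le: "\<exists>L0 D0. L0 \<ge> 0 \<and> D0 \<ge> 0 \<and>
  (\<forall>t. \<bar>integral {0..2*pi} (\<lambda>y. u (Complex t y))\<bar> \<le> L0 + D0 * \<bar>t\<bar>)"
proof -
  define L where "L = (\<lambda>t. integral {0..2*pi} (\<lambda>y. u (Complex t y)))"
  define D where "D = (\<lambda>t. Re (2 * circle_integral a t))"
  have dRe: "((\<lambda>t. Re (F t)) has_vector_derivative Re D) (at t within S)"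
    if "(F has_vector_derivative D) (at t within S)" for F D t S
    using bounded_linear.has_vector_derivative[OF bounded_linear_Re that] .
  have q: "continuous_on UNIV (\<lambda>w. - (exp (2 * u w) / 4))" by (intro continuous_intros cont_u) simp
  have q': "circle_integral (\<lambda>w. of_real (- (exp (2 * u w) / 4))) t = of_real (- (E t / 4))" for t
    unfolding circle_integral_of_real[OF q] E_def
    by simp
  have dL: "(L has_vector_derivative D t) (at t within S)" for t S
  proof -
    have "circle_integral (\<lambda>w. of_real (u w)) = (\<lambda>t. of_real (L t))"
      unfolding L_def circle_integral_of_real[OF cont_u, abs_def] ..
    moreover have "(circle_integral (\<lambda>w. of_real (u w)) has_vector_derivative 2 * circle_integral a t) (at t within S)"
      by (rule circle_integral_wirtinger(2)[OF wirtinger_u]) (auto intro!: continuous_intros cont_a simp: periodic_u)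
    ultimately show ?thesis using dRe unfolding D_def by fastforce
  qed
  have dD: "(D has_vector_derivative - E t) (at t within S)" for t S
  proof -
    have "continuous_on UNIV (\<lambda>w. complex_of_real (- (exp (2 * u w) / 4)))"
      by (rule continuous_on_of_real[OF q])
    note c = circle_integral_wirtinger[OF wirtinger_a periodic_a cont_b this]
    have "(circle_integral a has_vector_derivative of_real (- (E t / 2))) (at t within S)"
      using c(2)[of t S] unfolding c(1) q' by simp
    then have "((\<lambda>t. 2 * circle_integral a t) has_vector_derivative 2 * of_real (- (E t / 2))) (at t within S)"
      by (rule has_vector_derivative_mult_right)
    from dRe[OF this] show ?thesis unfolding D_def by simp
  qed
  have D_diff: "\<bar>D t - D s\<bar> \<le> area" if "s \<le> t" for s t
  proof -
    have "((\<lambda>t. - E t) has_integral (D t - D s)) {s..t}"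
      by (rule fundamental_theorem_of_calculus[OF that]) (rule dD)
    from integral_unique[OF this] have "D t - D s = - integral {s..t} E" by simp
    with E_integral[of s t] show ?thesis by simp
  qed
  have D_le: "\<bar>D t\<bar> \<le> \<bar>D 0\<bar> + area" for t
    using D_diff[of 0 t] D_diff[of t 0] by (cases "t \<ge> 0") linarith+
  have "\<bar>L t - L 0\<bar> \<le> (\<bar>D 0\<bar> + area) * \<bar>t - 0\<bar>" for t
    using field_differentiable_bound[of UNIV L D "\<bar>D 0\<bar> + area" t 0] dL D_le
    by (simp add: has_real_derivative_iff_has_vector_derivative)
  then have "\<bar>L t\<bar> \<le> \<bar>L 0\<bar> + (\<bar>D 0\<bar> + area) * \<bar>t\<bar>" for t
    by (smt (verit, best))
  then show ?thesis unfolding L_def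
    by (intro exI[of _ "\<bar>L 0\<bar>"] exI[of _ "\<bar>D 0\<bar> + area"]) (use area_nonneg in \<open>auto simp: L_def\<close>)
qed

text \<open>As \<open>- u\<close> is subharmonic, its value at a point is bounded by the integral of
  its positive part \<open>g\<close> over a strip around the point. By
  \<open>g \<le> exp (2 * u) - u\<close> that integral is controlled by the area and by the linear
  bound on the circle integrals of \<open>u\<close>.\<close>

lemma u_lower_bound: "\<exists>C\<ge>0. \<forall>w. - u w \<le> C * (1 + \<bar>Re w\<bar>)"
proof -
  obtain L0 D0 where L: "L0 \<ge> 0" "D0 \<ge> 0"
    "\<And>t. \<bar>integral {0..2*pi} (\<lambda>y. u (Complex t y))\<bar> \<le> L0 + D0 * \<bar>t\<bar>"
    using mean_u_le by auto
  \<comment> \<open>The mean value inequality is applied to the differentiable function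
    \<open>- u\<close>; \<open>g\<close> supplies the nonnegativity that the passage from circles to
    the strip requires.\<close>
  define g where "g = (\<lambda>w. max 0 (- u w))"
  have cg: "continuous_on S g" for S unfolding g_def by (intro continuous_intros cont_u)
  have g_int: "integral {0..2*pi} (\<lambda>y. g (Complex t y)) \<le> E t + (L0 + D0 * \<bar>t\<bar>)" for t
  proof -
    have "g w \<le> exp (2 * u w) - u w" for w
      using exp_ge_add_one_self[of "2 * u w"] exp_gt_zero[of "2 * u w"] unfolding g_def by linarith
    then have "integral {0..2*pi} (\<lambda>y. g (Complex t y)) \<le> integral {0..2*pi} (\<lambda>y. exp (2 * u (Complex t y)) - u (Complex t y))"
      by (intro integral_le integrable_on_Complex cg) (auto intro!: continuous_on_diff cont_u cont_exp_u)
    also have "\<dots> = E t - integral {0..2*pi} (\<lambda>y. u (Complex t y))"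
      unfolding E_def by (intro integral_diff integrable_on_Complex cont_u cont_exp_u)
    finally show ?thesis using L(3)[of t] by linarith
  qed
  have w1: "has_wirtinger (\<lambda>w. of_real (- u w)) (\<lambda>w. - a w) (\<lambda>w. - cnj (a w))"
    using has_wirtinger_cmult[OF wirtinger_u, of "-1"] by simp
  have w2: "has_wirtinger (\<lambda>w. - a w) (\<lambda>w. - b w) (\<lambda>w. of_real (exp (2 * u w) / 4))"
    using has_wirtinger_cmult[OF wirtinger_a, of "-1"] by simp
  have bound: "pi * (- u c) \<le> 4 * (area + 2 * (L0 + D0 * (\<bar>Re c\<bar> + 1)))" for c
  proof -
    have "pi * (- u c) \<le> 4 * integral {Re c - 1..Re c + 1} (\<lambda>t. integral {0..2*pi} (\<lambda>y. g (Complex t y)))"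
    proof (rule circle_to_strip_bound[OF cg])
      fix s
      have "2 * pi * (- u c) \<le> integral {0..2*pi} (\<lambda>y. - u (c + of_real (exp s) * cis y))"
        by (rule subharmonic_circle_mean[OF w1 w2]) (auto intro!: continuous_intros cont_a cont_b cont_u)
      also have "\<dots> \<le> integral {0..2*pi} (\<lambda>y. g (c + of_real (exp s) * cis y))"
        by (rule integral_le; (intro integrable_continuous_real continuous_intros continuous_on_compose2[OF cont_u] continuous_on_compose2[OF cg] order.refl)?)
           (auto simp: g_def)
      finally show "2 * pi * (- u c) \<le> integral {0..2*pi} (\<lambda>y. g (c + of_real (exp s) * cis y))" .
    qed (simp_all add: g_def periodic_u)
    also have "integral {Re c - 1..Re c + 1} (\<lambda>t. integral {0..2*pi} (\<lambda>y. g (Complex t y)))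
        \<le> integral {Re c - 1..Re c + 1} (\<lambda>t. E t + (L0 + D0 * (\<bar>Re c\<bar> + 1)))"
    proof (rule integral_le)
      fix t assume "t \<in> {Re c - 1..Re c + 1}"
      then have "D0 * \<bar>t\<bar> \<le> D0 * (\<bar>Re c\<bar> + 1)" by (intro mult_left_mono L) auto
      then show "integral {0..2*pi} (\<lambda>y. g (Complex t y)) \<le> E t + (L0 + D0 * (\<bar>Re c\<bar> + 1))"
        using g_int[of t] by linarith
    qed (intro integrable_circle cg integrable_add E_integrable integrable_const_ivl)+
    also have "\<dots> = integral {Re c - 1..Re c + 1} E + 2 * (L0 + D0 * (\<bar>Re c\<bar> + 1))"
      by (subst integral_add) (simp_all add: E_integrable integrable_const_ivl)
    also have "integral {Re c - 1..Re c + 1} E \<le> area" by (rule E_integral)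
    finally show ?thesis by simp
  qed
  define C where "C = 4 * (area + 2 * (L0 + D0))"
  have C: "C \<ge> 0" using L area_nonneg by (simp add: C_def)
  have "- u w \<le> C * (1 + \<bar>Re w\<bar>)" for w
  proof (cases "- u w \<le> 0")
    case True
    then show ?thesis using C by (smt (verit) mult_nonneg_nonneg)
  next
    case False
    then have "- u w \<le> pi * (- u w)" using pi_gt3 mult_right_mono[of 1 pi "- u w"] by simp
    also note bound[of w]
    also have "4 * (area + 2 * (L0 + D0 * (\<bar>Re w\<bar> + 1))) \<le> C * (1 + \<bar>Re w\<bar>)"
      using L area_nonneg unfolding C_def by (simp add: algebra_simps)
    finally show ?thesis .
  qed
  with C show ?thesis by blast
qed

end

section \<open>The Liouville stress tensor\<close>

context liouville_cylinder
begin

text \<open>\<open>T\<close> is half the Schwarzian derivative of a local developing map, that is,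
  of a holomorphic map that pulls the round metric back to \<open>exp (2 * u)\<close> times the flat
  one.\<close>

definition T :: "complex \<Rightarrow> complex" where
  "T w = b w - (a w)\<^sup>2"

definition h :: "complex \<Rightarrow> real" where
  "h w = exp (- u w)"

lemma h_pos: "h w > 0"
  by (simp add: h_def)

lemma cont_T: "continuous_on S T"
  unfolding T_def by (intro continuous_intros cont_a continuous_on_subset[OF cont_b]) auto

lemma cont_h: "continuous_on S h"
  unfolding h_def by (intro continuous_intros cont_u)

lemma periodic_T: "T (w + 2 * of_real pi * \<i>) = T w"
  by (simp add: T_def periodic_a periodic_b)

lemma periodic_h: "h (w + 2 * of_real pi * \<i>) = h w"
  by (simp add: h_def periodic_u)

lemma wirtinger_exp_u:
  "has_wirtinger (\<lambda>w. of_real (exp (k * u w))) (\<lambda>w. of_real k * of_real (exp (k * u w)) * a w)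
     (\<lambda>w. of_real k * of_real (exp (k * u w)) * cnj (a w))"
proof -
  have "((\<lambda>z. exp (of_real k * z)) has_field_derivative of_real k * exp (of_real k * z)) (at z)" for z :: complex
    by (auto intro!: derivative_eq_intros)
  from has_wirtinger_chain_left[OF wirtinger_u this]
  show ?thesis by (rule has_wirtinger_cong) (simp_all add: exp_of_real[symmetric])
qed

lemma wirtinger_h: "has_wirtinger (\<lambda>w. of_real (h w)) (\<lambda>w. - (a w * h w)) (\<lambda>w. - (cnj (a w) * h w))"
  using wirtinger_exp_u[of "-1"] by (simp add: h_def mult.commute)

lemma wirtinger_hw:
  "has_wirtinger (\<lambda>w. - (a w * h w)) (\<lambda>w. - (T w * h w))
     (\<lambda>w. of_real ((norm (a w))\<^sup>2 + exp (2 * u w) / 4) * h w)"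
proof -
  have "has_wirtinger (\<lambda>w. (-1) * (a w * h w)) (\<lambda>w. (-1) * (b w * h w + a w * - (a w * h w)))
    (\<lambda>w. (-1) * (complex_of_real (- (exp (2 * u w) / 4)) * of_real (h w) + a w * - (cnj (a w) * h w)))"
    by (intro has_wirtinger_cmult has_wirtinger_mult wirtinger_a wirtinger_h)
  then show ?thesis
  proof (rule has_wirtinger_cong)
    fix w
    show "- 1 * (complex_of_real (- (exp (2 * u w) / 4)) * of_real (h w) + a w * - (cnj (a w) * h w)) =
        of_real ((norm (a w))\<^sup>2 + exp (2 * u w) / 4) * h w"
      using complex_norm_square[of "a w"] by (simp add: algebra_simps)
  qed (simp_all add: T_def algebra_simps power2_eq_square)
qed

text \<open>As \<open>u\<close> is only of class \<open>C\<^sup>2\<close>, \<open>T\<close> cannot be differentiated directly. But the form with coefficients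
  \<open>a\<^sup>2\<close> and \<open>- exp (2u) / 4\<close> is of class \<open>C\<^sup>1\<close> and closed, and \<open>T\<close> is the complex derivative of \<open>a - P\<close> for a primitive
  \<open>P\<close> of that form.\<close>

lemma T_entire: "\<exists>T'. \<forall>w. (T has_field_derivative T' w) (at w)"
proof -
  define q where "q = (\<lambda>w. complex_of_real (- (exp (2 * u w) / 4)))"
  have wq: "has_wirtinger q (\<lambda>w. 2 * a w * q w) (\<lambda>w. 2 * cnj (a w) * q w)"
    using has_wirtinger_cmult[OF wirtinger_exp_u[of 2], of "- 1 / 4"]
    by (rule has_wirtinger_cong) (simp_all add: q_def)
  have wa2: "has_wirtinger (\<lambda>w. (a w)\<^sup>2) (\<lambda>w. 2 * a w * b w) (\<lambda>w. 2 * a w * q w)"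
    using has_wirtinger_mult[OF wirtinger_a wirtinger_a]
    by (rule has_wirtinger_cong) (simp_all add: q_def power2_eq_square)
  have cq: "continuous_on UNIV q" by (rule has_wirtinger_continuous[OF wq])
  have "\<exists>P. has_wirtinger P (\<lambda>w. (a w)\<^sup>2) q"
    by (rule poincare_wirtinger[OF wa2 wq]) (intro continuous_intros cont_a cont_b cq)+
  then obtain P where P: "has_wirtinger P (\<lambda>w. (a w)\<^sup>2) q" ..
  have "has_wirtinger (\<lambda>w. a w - P w) T (\<lambda>w. 0)"
    using has_wirtinger_diff[OF wirtinger_a P] by (rule has_wirtinger_cong) (simp_all add: T_def q_def)
  from has_wirtingerD[OF this] have F: "((\<lambda>w. a w - P w) has_field_derivative T w) (at w)" for w
    by (simp add: has_field_derivative_def)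
  then have "(\<lambda>w. a w - P w) holomorphic_on UNIV" by (auto simp: holomorphic_on_open)
  then have "deriv (\<lambda>w. a w - P w) holomorphic_on UNIV" by (simp add: holomorphic_deriv)
  moreover have "deriv (\<lambda>w. a w - P w) = T" using F DERIV_imp_deriv by blast
  ultimately show ?thesis by (simp add: holomorphic_on_open field_differentiable_def) metis
qed

lemma T_holomorphic: "T holomorphic_on UNIV"
  using T_entire by (auto simp: holomorphic_on_open)

section \<open>The virial identity and the interior estimate\<close>

definition X :: "real \<Rightarrow> real" where
  "X t = integral {0..2*pi} (\<lambda>y. (norm (T (Complex t y)))\<^sup>2 * h (Complex t y))"

definition H :: "real \<Rightarrow> real" where
  "H t = integral {0..2*pi} (\<lambda>y. h (Complex t y))"

definition V :: "real \<Rightarrow> real" where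
  "V t = integral {0..2*pi} (\<lambda>y. norm (T (Complex t y)) * h (Complex t y))"

text \<open>As \<open>cnj T\<close> is antiholomorphic, no derivative of \<open>T\<close> appears when \<open>h cnj T\<close> is differentiated with respect to \<open>w\<close>.\<close>

lemma virial:
  "\<exists>z z1. (\<forall>t. (z has_real_derivative z1 t) (at t)) \<and>
          (\<forall>t. (z1 has_real_derivative 4 * X t) (at t)) \<and> (\<forall>t. \<bar>z t\<bar> \<le> V t)"
proof -
  obtain T' where T': "\<And>w. (T has_field_derivative T' w) (at w)" using T_entire by blast
  have wT: "has_wirtinger (\<lambda>w. cnj (T w)) (\<lambda>w. 0) (\<lambda>w. cnj (T' w))"
    using has_wirtinger_cnj[OF has_wirtinger_holomorphic[OF T']] by simp
  have cT': "continuous_on UNIV T'"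
  proof -
    have "deriv T = T'" using T' DERIV_imp_deriv by blast
    then show ?thesis using holomorphic_deriv[OF T_holomorphic open_UNIV] holomorphic_on_imp_continuous_on by metis
  qed
  define f where "f = (\<lambda>w. cnj (T w) * of_real (h w))"
  define g where "g = (\<lambda>w. cnj (T w) * - (a w * h w))"
  have w1: "has_wirtinger f g (\<lambda>w. cnj (T' w) * h w + cnj (T w) * - (cnj (a w) * h w))"
    using has_wirtinger_mult[OF wT wirtinger_h] unfolding f_def g_def by simp
  have w2: "has_wirtinger g (\<lambda>w. of_real (- ((norm (T w))\<^sup>2 * h w)))
     (\<lambda>w. cnj (T' w) * - (a w * h w) + cnj (T w) * (of_real ((norm (a w))\<^sup>2 + exp (2 * u w) / 4) * h w))"
    using has_wirtinger_mult[OF wT wirtinger_hw] unfolding g_def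
  proof (rule has_wirtinger_cong)
    show "0 * - (a w * complex_of_real (h w)) + cnj (T w) * - (T w * complex_of_real (h w)) =
        complex_of_real (- ((norm (T w))\<^sup>2 * h w))" for w
      unfolding of_real_minus of_real_mult complex_norm_square by simp
  qed simp_all
  have cV: "continuous_on UNIV (\<lambda>w. - ((norm (T w))\<^sup>2 * h w))"
    by (intro continuous_intros cont_T cont_h)
  have d1: "(circle_integral f has_vector_derivative 2 * circle_integral g t) (at t)" for t
    by (rule circle_integral_wirtinger(2)[OF w1])
       (auto simp: f_def g_def periodic_T periodic_h intro!: continuous_intros cont_T cont_h cont_a cT')
  have d2: "(circle_integral g has_vector_derivative 2 * of_real (- X t)) (at t)" for t
  proof -
    have "(circle_integral g has_vector_derivative 2 * circle_integral (\<lambda>w. of_real (- ((norm (T w))\<^sup>2 * h w))) t) (at t)"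
      by (rule circle_integral_wirtinger(2)[OF w2])
         (auto simp: g_def periodic_T periodic_h periodic_a intro!: continuous_intros cont_T cont_h cont_a cont_u cT')
    then show ?thesis unfolding circle_integral_of_real[OF cV] by (simp add: X_def)
  qed
  have dRe: "((\<lambda>t. Re (F t)) has_real_derivative Re D) (at t)" if "(F has_vector_derivative D) (at t)" for F D t
    using bounded_linear.has_vector_derivative[OF bounded_linear_Re that]
    by (simp add: has_real_derivative_iff_has_vector_derivative)
  \<comment> \<open>Real part and sign are chosen so that \<open>z\<close> is a real function with
    nonnegative second derivative.\<close>
  have "((\<lambda>t. - Re (circle_integral f t)) has_real_derivative - 2 * Re (circle_integral g t)) (at t)" for t
    using DERIV_minus[OF dRe[OF d1[of t]]] by simp
  moreover have "((\<lambda>t. - 2 * Re (circle_integral g t)) has_real_derivative 4 * X t) (at t)" for t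
    using DERIV_cmult[OF dRe[OF d2[of t]], of "- 2"] by simp
  moreover have "\<bar>- Re (circle_integral f t)\<bar> \<le> V t" for t
  proof -
    have "\<bar>- Re (circle_integral f t)\<bar> \<le> norm (circle_integral f t)"
      using abs_Re_le_cmod by simp
    also have "\<dots> \<le> V t"
      unfolding circle_integral_def V_def f_def
      by (intro integral_norm_bound_integral integrable_on_Complex)
         (auto intro!: continuous_intros cont_T cont_h simp: norm_mult h_pos[THEN less_imp_le])
    finally show ?thesis .
  qed
  ultimately show ?thesis
    by (intro exI[of _ "\<lambda>t. - Re (circle_integral f t)"] exI[of _ "\<lambda>t. - 2 * Re (circle_integral g t)"]) auto
qed

lemma cont_XHV: "continuous_on S X" "continuous_on S H" "continuous_on S V"
  unfolding X_def H_def V_def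
  by (intro cont_circle continuous_intros cont_T cont_h)+

text \<open>An interior estimate. The identity \<open>z'' = 4 * X\<close> is tested against the
  cut-off \<open>r ^ 4\<close>, both derivatives are moved to the cut-off, and since \<bar>z\<bar>
  \<le> V, half of \<open>4 * X\<close> absorbs the result at the price of a multiple of
  \<open>H\<close>.\<close>

lemma caccioppoli:
  "integral {s - 1..s + 1} X \<le> 36 * integral {s - 2..s + 2} H"
proof -
  obtain z z1 where dz: "\<And>t. (z has_real_derivative z1 t) (at t)"
    and dz1: "\<And>t. (z1 has_real_derivative 4 * X t) (at t)" and zV: "\<And>t. \<bar>z t\<bar> \<le> V t"
    using virial by blast
  \<comment> \<open>\<open>r\<close> vanishes at \<open>s - 2\<close> and \<open>s + 2\<close>. The
    fourth power removes the boundary terms and makes the second derivative of the cut-off at most a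
    multiple of \<open>r\<^sup>2\<close>, the square root of the cut-off, as the absorption
    requires.\<close>
  define r where "r = (\<lambda>t. 1 - ((t - s) / 2)\<^sup>2)"
  define \<phi>1 where "\<phi>1 = (\<lambda>t. - 2 * (t - s) * r t ^ 3)"
  define \<phi>2 where "\<phi>2 = (\<lambda>t. - 2 * r t ^ 3 + 3 * (t - s)\<^sup>2 * r t ^ 2)"
  have dr: "(r has_real_derivative - (t - s) / 2) (at t)" for t
    unfolding r_def by (auto intro!: derivative_eq_intros simp: field_simps)
  have d\<phi>: "((\<lambda>t. r t ^ 4) has_real_derivative \<phi>1 t) (at t)" for t
    unfolding \<phi>1_def by (auto intro!: derivative_eq_intros dr simp: field_simps)
  have d\<phi>1: "(\<phi>1 has_real_derivative \<phi>2 t) (at t)" for t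
    unfolding \<phi>1_def \<phi>2_def
    by (auto intro!: derivative_eq_intros dr simp: power2_eq_square field_simps)
  have cr: "continuous_on S r" for S unfolding r_def by (intro continuous_intros) auto
  have c\<phi>2: "continuous_on S \<phi>2" for S unfolding \<phi>2_def by (intro continuous_intros cr)
  have cz: "continuous_on S z" for S
    using dz by (meson DERIV_isCont continuous_at_imp_continuous_on)
  have ftc: "((\<lambda>t. 4 * X t * r t ^ 4 - z t * \<phi>2 t) has_integral
      (z1 (s+2) * r (s+2) ^ 4 - z (s+2) * \<phi>1 (s+2)) - (z1 (s-2) * r (s-2) ^ 4 - z (s-2) * \<phi>1 (s-2))) {s-2..s+2}"
  proof (rule fundamental_theorem_of_calculus)
    fix t
    have "((\<lambda>t. z1 t * r t ^ 4 - z t * \<phi>1 t) has_real_derivative 4 * X t * r t ^ 4 - z t * \<phi>2 t) (at t)"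
      by (rule derivative_eq_intros dz dz1 d\<phi> d\<phi>1 refl)+ (simp add: algebra_simps)
    then show "((\<lambda>t. z1 t * r t ^ 4 - z t * \<phi>1 t) has_vector_derivative 4 * X t * r t ^ 4 - z t * \<phi>2 t) (at t within {s-2..s+2})"
      by (simp add: has_real_derivative_iff_has_vector_derivative has_vector_derivative_at_within)
  qed simp
  have pointwise: "2 * X t * r t ^ 4 - 18 * H t \<le> 4 * X t * r t ^ 4 - z t * \<phi>2 t" if t: "t \<in> {s-2..s+2}" for t
  proof -
    have "(t - s)\<^sup>2 \<le> 2\<^sup>2" using t by (intro power2_le_iff_abs_le[THEN iffD2]) auto
    then have q: "(t - s)\<^sup>2 \<le> 4" by simp
    then have r01: "0 \<le> r t" "r t \<le> 1" by (auto simp: r_def power_divide)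
    \<comment> \<open>With \<open>0 \<le> r t \<le> 1\<close> and
      \<open>(t - s)\<^sup>2 \<le> 4\<close> the expression lies between \<open>-2\<close> and
      \<open>12\<close>.\<close>
    have "\<bar>- 2 * r t + 3 * (t - s)\<^sup>2\<bar> \<le> 12"
      using q r01 zero_le_power2[of "t - s"] by linarith
    then have "\<bar>\<phi>2 t\<bar> \<le> 12 * (r t)\<^sup>2"
    proof -
      have "\<phi>2 t = (- 2 * r t + 3 * (t - s)\<^sup>2) * (r t)\<^sup>2"
        by (simp add: \<phi>2_def algebra_simps power2_eq_square power3_eq_cube)
      with \<open>\<bar>- 2 * r t + 3 * (t - s)\<^sup>2\<bar> \<le> 12\<close> show ?thesis
        by (simp add: abs_mult mult_right_mono)
    qed
    then have "\<bar>z t\<bar> * \<bar>\<phi>2 t\<bar> \<le> V t * (12 * (r t)\<^sup>2)"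
      using zV[of t] by (intro mult_mono) linarith+
    then have "z t * \<phi>2 t \<le> V t * (12 * (r t)\<^sup>2)"
      using abs_ge_self[of "z t * \<phi>2 t"] by (simp add: abs_mult)
    also have "\<dots> \<le> 2 * X t * r t ^ 4 + 18 * H t"
    proof -
      let ?k = "\<lambda>y. 12 * (r t)\<^sup>2 * (norm (T (Complex t y)) * h (Complex t y))"
      let ?l = "\<lambda>y. 2 * r t ^ 4 * ((norm (T (Complex t y)))\<^sup>2 * h (Complex t y)) + 18 * h (Complex t y)"
      have "V t * (12 * (r t)\<^sup>2) = integral {0..2*pi} ?k"
        unfolding V_def by simp
      also have "\<dots> \<le> integral {0..2*pi} ?l"
      proof (rule integral_le)
        fix y
        \<comment> \<open>Completing the square: \<open>12 * x \<le> 2 * x\<^sup>2 + 18\<close> with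
          \<open>x = norm (T (Complex t y)) * (r t)\<^sup>2\<close>.\<close>
        have "0 \<le> 2 * (norm (T (Complex t y)) * (r t)\<^sup>2 - 3)\<^sup>2 * h (Complex t y)"
          using h_pos[of "Complex t y"] by (intro mult_nonneg_nonneg) auto
        then show "?k y \<le> ?l y"
          by (simp add: power2_eq_square algebra_simps power4_eq_xxxx)
      qed (auto intro!: integrable_continuous_real continuous_intros continuous_on_Complex_arg cont_T cont_h)
      also have "integral {0..2*pi} ?l = 2 * r t ^ 4 * X t + 18 * H t"
        unfolding X_def H_def
        by (subst integral_add) (auto intro!: integrable_continuous_real continuous_intros continuous_on_Complex_arg cont_T cont_h)
      finally show ?thesis by (simp add: mult_ac)
    qed
    finally show ?thesis by linarith
  qed
  have "integral {s-2..s+2} (\<lambda>t. 2 * X t * r t ^ 4 - 18 * H t) \<le> integral {s-2..s+2} (\<lambda>t. 4 * X t * r t ^ 4 - z t * \<phi>2 t)"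
    by (rule integral_le[OF _ _ pointwise])
       (auto intro!: integrable_continuous_real continuous_intros cont_XHV cr c\<phi>2 cz)
  also have "\<dots> = 0"
    using integral_unique[OF ftc] by (simp add: r_def \<phi>1_def)
  finally have main: "2 * integral {s-2..s+2} (\<lambda>t. X t * r t ^ 4) \<le> 18 * integral {s-2..s+2} H"
    by (subst (asm) integral_diff)
       (auto intro!: integrable_continuous_real continuous_intros cont_XHV cr simp: mult.assoc)
  have X0: "X t \<ge> 0" for t
    unfolding X_def by (intro integral_nonneg integrable_on_Complex)
      (auto intro!: continuous_intros cont_T cont_h simp: h_pos[THEN less_imp_le])
  have "integral {s-1..s+1} X \<le> integral {s-1..s+1} (\<lambda>t. 4 * (X t * r t ^ 4))"
  proof (rule integral_le)
    fix t assume t: "t \<in> {s-1..s+1}"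
    have "(t - s)\<^sup>2 \<le> 1\<^sup>2" using t by (intro power2_le_iff_abs_le[THEN iffD2]) auto
    then have "3/4 \<le> r t" by (simp add: r_def power_divide)
    \<comment> \<open>\<open>(3/4) ^ 4 = 81/256\<close> exceeds \<open>1/4\<close>. The factor
      \<open>4\<close>, together with \<open>18 / 2 = 9\<close> from \<open>main\<close>, gives the
      constant \<open>36\<close>.\<close>
    then have "(3/4) ^ 4 \<le> r t ^ 4" by (intro power_mono) auto
    then have "1 \<le> 4 * r t ^ 4" by (simp add: power4_eq_xxxx)
    from mult_left_mono[OF this X0[of t]] show "X t \<le> 4 * (X t * r t ^ 4)" by simp
  qed (auto intro!: integrable_continuous_real continuous_intros cont_XHV cr)
  also have "\<dots> \<le> integral {s-2..s+2} (\<lambda>t. 4 * (X t * r t ^ 4))"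
    by (intro integral_subset_le) (auto intro!: integrable_continuous_real continuous_intros cont_XHV cr X0 mult_nonneg_nonneg)
  also have "\<dots> = 4 * integral {s-2..s+2} (\<lambda>t. X t * r t ^ 4)" by simp
  finally show ?thesis using main by linarith
qed

end

section \<open>Growth and constancy of \<open>T\<close>\<close>

context liouville_cylinder
begin

lemma cont_E: "continuous_on S E"
  unfolding E_def by (intro cont_circle cont_exp_u)

lemma h_exp_bound: "\<exists>C\<ge>0. \<forall>w. h w \<le> exp (C * (1 + \<bar>Re w\<bar>))"
  using u_lower_bound unfolding h_def by auto

text \<open>The mean value property bounds \<open>T c\<close> by the integral of \<bar>T\<bar> over
  a strip of width \<open>2\<close>. There \<bar>T\<bar> is dominated by the density of
  \<open>X\<close> plus \<open>1 + exp (2 * u)\<close>; \<open>caccioppoli\<close> replaces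
  \<open>X\<close> by \<open>H\<close>, which grows at most exponentially because \<open>h\<close>
  does.\<close>

lemma T_exp_bound: "\<exists>K\<ge>0. \<exists>N::nat. \<forall>w. norm (T w) \<le> K * exp (of_nat N * \<bar>Re w\<bar>)"
proof -
  obtain C where C: "C \<ge> 0" "\<And>w. h w \<le> exp (C * (1 + \<bar>Re w\<bar>))" using h_exp_bound by auto
  obtain T' where T': "\<And>w. (T has_field_derivative T' w) (at w)" using T_entire by blast
  define N where "N = nat \<lceil>C\<rceil>"
  have CN: "C \<le> of_nat N" unfolding N_def by linarith
  \<comment> \<open>\<open>4\<close> comes from \<open>circle_to_strip_bound\<close> and
    \<open>36\<close> from \<open>caccioppoli\<close>. The strip of length \<open>4\<close> has area
    \<open>4 * (2 * pi)\<close>, and on it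
    \<open>1 + \<bar>t\<bar> \<le> 3 + \<bar>Re c\<bar>\<close>, which yields
    \<open>exp (3 * C)\<close>. The remainder bounds the integral of \<open>2 * pi + E\<close> over
    length \<open>2\<close>.\<close>
  define K where "K = 4 * (36 * (4 * (2 * pi * exp (3 * C))) + (4 * pi + area))"
  have K: "K \<ge> 0" using area_nonneg by (simp add: K_def)
  have "norm (T c) \<le> K * exp (of_nat N * \<bar>Re c\<bar>)" for c
  proof -
    let ?s = "Re c"
    have "pi * norm (T c) \<le> 4 * integral {?s - 1..?s + 1} (\<lambda>t. integral {0..2*pi} (\<lambda>y. norm (T (Complex t y))))"
    proof (rule circle_to_strip_bound)
      fix s
      have cT: "continuous_on UNIV (\<lambda>w. T (log_shift c w))"
        unfolding log_shift_def by (intro continuous_on_compose2[OF cont_T] continuous_intros) auto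
      have "2 * pi * norm (T c) = norm (circle_integral (\<lambda>w. T (log_shift c w)) s)"
        unfolding holomorphic_circle_mean[OF T'] by (simp add: norm_mult)
      also have "\<dots> \<le> integral {0..2*pi} (\<lambda>y. norm (T (c + of_real (exp s) * cis y)))"
        unfolding circle_integral_def log_shift_Complex
        by (rule integral_norm_bound_integral)
           (auto intro!: integrable_continuous_real continuous_intros continuous_on_compose2[OF cont_T])
      finally show "2 * pi * norm (T c) \<le> integral {0..2*pi} (\<lambda>y. norm (T (c + of_real (exp s) * cis y)))" .
    qed (auto intro!: continuous_intros cont_T simp: periodic_T)
    also have "integral {?s - 1..?s + 1} (\<lambda>t. integral {0..2*pi} (\<lambda>y. norm (T (Complex t y))))
        \<le> integral {?s - 1..?s + 1} (\<lambda>t. X t + (2 * pi + E t))"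
    proof (rule integral_le)
      fix t
      have "norm (T w) \<le> (norm (T w))\<^sup>2 * h w + (1 + exp (2 * u w))" for w
      proof -
        \<comment> \<open>The exponentials in the cross term cancel, so it is exactly
          \<open>norm (T w)\<close>.\<close>
        have "0 \<le> (norm (T w) * exp (- u w / 2) - exp (u w / 2) / 2)\<^sup>2" by simp
        also have "\<dots> = (norm (T w))\<^sup>2 * h w - norm (T w) + exp (u w) / 4"
          by (simp add: power2_eq_square algebra_simps h_def flip: exp_add)
        finally have "norm (T w) \<le> (norm (T w))\<^sup>2 * h w + exp (u w) / 4" by simp
        \<comment> \<open>\<open>exp u\<close> is traded for \<open>exp (2 * u)\<close>, whose
          integral the area bounds.\<close>
        also have "exp (u w) / 4 \<le> 1 + exp (2 * u w)"
        proof -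
          have "exp (2 * u w) = (exp (u w))\<^sup>2" by (rule exp_double)
          then show ?thesis using zero_le_power2[of "exp (u w) - 1"] zero_le_power2[of "exp (u w)"]
            by (simp add: power2_diff) (smt (verit) exp_gt_zero)
        qed
        finally show ?thesis by simp
      qed
      then have "integral {0..2*pi} (\<lambda>y. norm (T (Complex t y)))
          \<le> integral {0..2*pi} (\<lambda>y. (norm (T (Complex t y)))\<^sup>2 * h (Complex t y) + (1 + exp (2 * u (Complex t y))))"
        by (intro integral_le)
           (auto intro!: integrable_continuous_real continuous_intros continuous_on_Complex_arg cont_T cont_h cont_u)
      also have "\<dots> = X t + (2 * pi + E t)"
        unfolding X_def E_def
        by (subst integral_add, (auto intro!: integrable_continuous_real continuous_intros continuous_on_Complex_arg cont_T cont_h cont_u)[2],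
            subst integral_add) (auto intro!: integrable_continuous_real continuous_intros continuous_on_Complex_arg cont_T cont_h cont_u)
      finally show "integral {0..2*pi} (\<lambda>y. norm (T (Complex t y))) \<le> X t + (2 * pi + E t)" .
    qed (auto intro!: integrable_continuous_real continuous_intros cont_circle cont_E cont_T cont_XHV)
    also have "\<dots> = integral {?s - 1..?s + 1} X + (4 * pi + integral {?s - 1..?s + 1} E)"
    proof -
      have "integral {?s - 1..?s + 1} (\<lambda>t. X t + (2 * pi + E t)) =
          integral {?s - 1..?s + 1} X + integral {?s - 1..?s + 1} (\<lambda>t. 2 * pi + E t)"
        by (intro integral_add integrable_continuous_real continuous_intros cont_XHV cont_E)
      also have "integral {?s - 1..?s + 1} (\<lambda>t. 2 * pi + E t) = 4 * pi + integral {?s - 1..?s + 1} E"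
        by (subst integral_add) (auto intro!: E_integrable)
      finally show ?thesis .
    qed
    also have "\<dots> \<le> 36 * (4 * (2 * pi * exp (3 * C + C * \<bar>?s\<bar>))) + (4 * pi + area)"
    proof -
      have "integral {?s - 2..?s + 2} H \<le> integral {?s - 2..?s + 2} (\<lambda>t. 2 * pi * exp (3 * C + C * \<bar>?s\<bar>))"
      proof (rule integral_le)
        fix t assume t: "t \<in> {?s - 2..?s + 2}"
        have "H t \<le> integral {0..2*pi} (\<lambda>y. exp (3 * C + C * \<bar>?s\<bar>))"
          unfolding H_def
        proof (rule integral_le)
          fix y
          have "C * (1 + \<bar>t\<bar>) \<le> C * (3 + \<bar>?s\<bar>)" using t C(1) by (intro mult_left_mono) auto
          then have "exp (C * (1 + \<bar>t\<bar>)) \<le> exp (3 * C + C * \<bar>?s\<bar>)" by (simp add: algebra_simps)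
          then show "h (Complex t y) \<le> exp (3 * C + C * \<bar>?s\<bar>)"
            using order_trans[OF C(2)[of "Complex t y"]] by simp
        qed (auto intro!: integrable_on_Complex cont_h)
        then show "H t \<le> 2 * pi * exp (3 * C + C * \<bar>?s\<bar>)" by simp
      qed (auto intro!: integrable_continuous_real cont_XHV)
      then have "integral {?s - 2..?s + 2} H \<le> 4 * (2 * pi * exp (3 * C + C * \<bar>?s\<bar>))" by simp
      with caccioppoli[of ?s] E_integral(2)[of "?s - 1" "?s + 1"] show ?thesis by linarith
    qed
    also have "\<dots> \<le> K / 4 * exp (of_nat N * \<bar>?s\<bar>)"
    proof -
      have e: "exp (C * \<bar>?s\<bar>) \<le> exp (of_nat N * \<bar>?s\<bar>)" using CN by (simp add: mult_right_mono)
      have e1: "1 \<le> exp (of_nat N * \<bar>?s\<bar>)" by simp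
      have "36 * (4 * (2 * pi * exp (3 * C + C * \<bar>?s\<bar>))) = 36 * (4 * (2 * pi * exp (3 * C))) * exp (C * \<bar>?s\<bar>)"
        by (simp add: exp_add)
      also have "\<dots> \<le> 36 * (4 * (2 * pi * exp (3 * C))) * exp (of_nat N * \<bar>?s\<bar>)"
        using e by (intro mult_left_mono) auto
      finally have "36 * (4 * (2 * pi * exp (3 * C + C * \<bar>?s\<bar>))) \<le> 36 * (4 * (2 * pi * exp (3 * C))) * exp (of_nat N * \<bar>?s\<bar>)" .
      moreover have "4 * pi + area \<le> (4 * pi + area) * exp (of_nat N * \<bar>?s\<bar>)"
        using mult_left_mono[OF e1, of "4 * pi + area"] area_nonneg by simp
      moreover have "K / 4 * exp (of_nat N * \<bar>?s\<bar>) = 36 * (4 * (2 * pi * exp (3 * C))) * exp (of_nat N * \<bar>?s\<bar>)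
          + (4 * pi + area) * exp (of_nat N * \<bar>?s\<bar>)"
        by (simp add: K_def algebra_simps)
      ultimately show ?thesis by linarith
    qed
    finally have "pi * norm (T c) \<le> K * exp (of_nat N * \<bar>?s\<bar>)" by simp
    moreover have "norm (T c) \<le> pi * norm (T c)"
      using pi_gt3 mult_right_mono[of 1 pi "norm (T c)"] by simp
    ultimately show ?thesis by linarith
  qed
  with K show ?thesis by blast
qed

text \<open>Where \<bar>T\<bar> \<ge> m, pointwise comparison gives \<open>X \<ge> m * V\<close> and
  hence \<open>z'' \<ge> 4 * m * z\<close>, so \<open>z\<close> grows exponentially with a rate
  fixed by \<open>m\<close> once it is positive and nondecreasing. As \<open>m\<close> is arbitrary,
  this rate can be made larger than that of the bound \<open>V\<close> for \<bar>z\<bar>.\<close>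

lemma T_not_to_infinity:
  assumes "\<And>m. \<exists>s. \<forall>w. Re w \<ge> s \<longrightarrow> norm (T w) \<ge> m"
  shows False
proof -
  obtain C where C: "C \<ge> 0" "\<And>w. h w \<le> exp (C * (1 + \<bar>Re w\<bar>))" using h_exp_bound by auto
  obtain K N where K: "K \<ge> 0" "\<And>w. norm (T w) \<le> K * exp (of_nat N * \<bar>Re w\<bar>)" using T_exp_bound by blast
  \<comment> \<open>\<open>V\<close> grows at most at the rate \<open>C + of_nat N\<close>, the sum
    of the rates of \<open>h\<close> and \<open>T\<close>; one more is enough for the
    contradiction.\<close>
  define \<kappa> where "\<kappa> = C + of_nat N + 1"
  have \<kappa>: "\<kappa> > 0" using C(1) by (simp add: \<kappa>_def)
  define m where "m = \<kappa>\<^sup>2 / 4"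
  have m: "m > 0" using \<kappa> by (simp add: m_def)
  obtain s where s: "\<And>w. Re w \<ge> s \<Longrightarrow> norm (T w) \<ge> m" using assms by blast
  obtain z z1 where dz: "\<And>t. (z has_real_derivative z1 t) (at t)"
    and dz1: "\<And>t. (z1 has_real_derivative 4 * X t) (at t)" and zV: "\<And>t. \<bar>z t\<bar> \<le> V t"
    using virial by blast
  have VH: "V t \<ge> m * H t" and XV: "X t \<ge> m * V t" if t: "t \<ge> s" for t
  proof -
    have T: "m \<le> norm (T (Complex t y))" for y using s[of "Complex t y"] t by simp
    have "m * H t = integral {0..2*pi} (\<lambda>y. m * h (Complex t y))" by (simp add: H_def)
    also have "\<dots> \<le> V t"
      unfolding V_def using T
      by (intro integral_le integrable_on_Complex)
         (auto intro!: integrable_continuous_real continuous_intros continuous_on_Complex_arg cont_T cont_h mult_right_mono simp: h_pos[THEN less_imp_le])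
    finally show "V t \<ge> m * H t" .
    have "m * V t = integral {0..2*pi} (\<lambda>y. m * (norm (T (Complex t y)) * h (Complex t y)))" by (simp add: V_def)
    also have "\<dots> \<le> X t"
      unfolding X_def using T
      by (intro integral_le)
         (auto intro!: integrable_continuous_real continuous_intros continuous_on_Complex_arg cont_T cont_h mult_right_mono
           simp: h_pos[THEN less_imp_le] power2_eq_square simp flip: mult.assoc)
    finally show "X t \<ge> m * V t" .
  qed
  \<comment> \<open>\<open>h\<close> and \<open>exp (2 * u)\<close> cannot both be small, so finite
    area makes the integral of \<open>H\<close> diverge linearly. This is what drives
    \<open>z1\<close>, and then \<open>z\<close>, to positive values.\<close>
  have H_int: "integral {s..t} H \<ge> 2 * pi * (t - s) - area" if t: "t \<ge> s" for t
  proof -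
    have "integral {s..t} (\<lambda>r. 2 * pi - E r) \<le> integral {s..t} H"
    proof (rule integral_le)
      fix r
      have "1 - exp (2 * u w) \<le> h w" for w
      proof (cases "u w \<ge> 0")
        case True
        then have "1 \<le> exp (2 * u w)" by simp
        with h_pos[of w] show ?thesis by linarith
      next
        case False
        then have "1 \<le> h w" by (simp add: h_def)
        with exp_gt_zero[of "2 * u w"] show ?thesis by linarith
      qed
      then have "integral {0..2*pi} (\<lambda>y. 1 - exp (2 * u (Complex r y))) \<le> H r"
        unfolding H_def
        by (intro integral_le) (auto intro!: integrable_continuous_real continuous_intros continuous_on_Complex_arg cont_u cont_h)
      also have "integral {0..2*pi} (\<lambda>y. 1 - exp (2 * u (Complex r y))) = 2 * pi - E r"
        unfolding E_def
        by (subst integral_diff) (auto intro!: integrable_continuous_real continuous_intros continuous_on_Complex_arg cont_u)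
      finally show "2 * pi - E r \<le> H r" .
    qed (auto intro!: integrable_continuous_real continuous_intros cont_E cont_XHV)
    moreover have "integral {s..t} (\<lambda>r. 2 * pi - E r) = 2 * pi * (t - s) - integral {s..t} E"
      using t by (subst integral_diff) (auto intro!: E_integrable)
    ultimately show ?thesis using E_integral(2)[of s t] by linarith
  qed
  have z1_ge: "z1 t \<ge> z1 s + 4 * m\<^sup>2 * (2 * pi * (t - s) - area)" if t: "t \<ge> s" for t
  proof -
    have "((\<lambda>r. 4 * X r) has_integral (z1 t - z1 s)) {s..t}"
      using dz1 by (intro fundamental_theorem_of_calculus[OF t])
        (simp add: has_real_derivative_iff_has_vector_derivative has_vector_derivative_at_within)
    then have "z1 t - z1 s = integral {s..t} (\<lambda>r. 4 * X r)" by (rule integral_unique[symmetric])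
    also have "\<dots> \<ge> integral {s..t} (\<lambda>r. 4 * m\<^sup>2 * H r)"
    proof (rule integral_le)
      fix r assume "r \<in> {s..t}"
      then have "m * (m * H r) \<le> m * V r" "m * V r \<le> X r"
        using m VH XV by (auto intro!: mult_left_mono)
      then show "4 * m\<^sup>2 * H r \<le> 4 * X r" by (simp add: power2_eq_square)
    qed (auto intro!: integrable_continuous_real continuous_intros cont_XHV)
    also have "integral {s..t} (\<lambda>r. 4 * m\<^sup>2 * H r) = 4 * m\<^sup>2 * integral {s..t} H" by simp
    finally show ?thesis using mult_left_mono[OF H_int[OF t], of "4 * m\<^sup>2"] by simp
  qed
  \<comment> \<open>\<open>p\<close> solves \<open>4 * m\<^sup>2 * (2 * pi * (p - s) - area) =
    \<bar>z1 s\<bar> + 1\<close>; from there on \<open>z1_ge\<close> yields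
    \<open>z1 t \<ge> 1\<close>.\<close>
  define p where "p = s + (area + (\<bar>z1 s\<bar> + 1) / (4 * m\<^sup>2)) / (2 * pi)"
  have ps: "p \<ge> s" using area_nonneg m by (simp add: p_def)
  have z1_1: "z1 t \<ge> 1" if t: "t \<ge> p" for t
  proof -
    have "(area + (\<bar>z1 s\<bar> + 1) / (4 * m\<^sup>2)) / (2 * pi) \<le> t - s" using t by (simp add: p_def)
    then have "area + (\<bar>z1 s\<bar> + 1) / (4 * m\<^sup>2) \<le> 2 * pi * (t - s)"
      by (simp add: pos_divide_le_eq mult.commute)
    then have "(\<bar>z1 s\<bar> + 1) / (4 * m\<^sup>2) \<le> 2 * pi * (t - s) - area" by simp
    then have "\<bar>z1 s\<bar> + 1 \<le> 4 * m\<^sup>2 * (2 * pi * (t - s) - area)"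
      using m by (simp add: pos_divide_le_eq mult.commute)
    with z1_ge[of t] t ps show ?thesis by linarith
  qed
  have z_ge: "z t \<ge> z p + (t - p)" if t: "t \<ge> p" for t
  proof -
    have "z p - p \<le> z t - t"
    proof (rule DERIV_nonneg_imp_nondecreasing[OF t])
      fix r assume "p \<le> r"
      then show "\<exists>y. ((\<lambda>t. z t - t) has_real_derivative y) (at r) \<and> 0 \<le> y"
        using z1_1[of r] by (intro exI[of _ "z1 r - 1"]) (auto intro!: derivative_eq_intros dz)
    qed
    then show ?thesis by simp
  qed
  \<comment> \<open>With slope at least \<open>1\<close> beyond \<open>p\<close>, the distance
    \<open>\<bar>z p\<bar> + 1\<close> lifts \<open>z\<close> to at least \<open>1\<close>.\<close>
  define q where "q = p + \<bar>z p\<bar> + 1"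
  have q: "q \<ge> p" "q \<ge> s" "z q > 0" "z1 q \<ge> 0"
    using ps z_ge[of q] z1_1[of q] by (auto simp: q_def)
  have "\<kappa>\<^sup>2 * z t \<le> 4 * X t" if "t \<ge> q" for t
  proof -
    have "m * z t \<le> m * V t" using zV[of t] m by (intro mult_left_mono) auto
    also have "\<dots> \<le> X t" using XV[of t] that q by simp
    finally show ?thesis by (simp add: m_def)
  qed
  then obtain c d where c: "c > 0" and cd: "\<And>t. t \<ge> q \<Longrightarrow> z t \<ge> c * exp (\<kappa> * t) + d * exp (- \<kappa> * t)"
    using exp_growth_of_convex[of q z z1 "\<lambda>t. 4 * X t" \<kappa>] dz dz1 \<kappa> q by blast
  have V_le: "V t \<le> 2 * pi * (K * exp C * exp ((\<kappa> - 1) * t))" if t: "t \<ge> 0" for t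
  proof -
    have "V t \<le> integral {0..2*pi} (\<lambda>y. K * exp C * exp ((\<kappa> - 1) * t))"
      unfolding V_def
    proof (rule integral_le)
      fix y
      have "norm (T (Complex t y)) * h (Complex t y) \<le> (K * exp (of_nat N * \<bar>t\<bar>)) * exp (C * (1 + \<bar>t\<bar>))"
        using K(2)[of "Complex t y"] C(2)[of "Complex t y"] K(1) h_pos[of "Complex t y"] by (intro mult_mono) auto
      also have "\<dots> = K * exp C * exp ((\<kappa> - 1) * t)"
        using t by (simp add: \<kappa>_def algebra_simps flip: exp_add)
      finally show "norm (T (Complex t y)) * h (Complex t y) \<le> K * exp C * exp ((\<kappa> - 1) * t)" .
    qed (auto intro!: integrable_continuous_real continuous_intros continuous_on_Complex_arg cont_T cont_h)
    then show ?thesis by (simp add: mult_ac)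
  qed
  \<comment> \<open>The lower and upper bounds for \<open>z\<close> are compared after
    multiplication by \<open>exp (- \<kappa> * t)\<close>: everything except \<open>c\<close>
    decays.\<close>
  have "c \<le> 2 * pi * (K * exp C) * exp (- t) - d * exp (- 2 * \<kappa> * t)" if "t \<ge> max 0 q" for t
  proof -
    have "c * exp (\<kappa> * t) + d * exp (- \<kappa> * t) \<le> 2 * pi * (K * exp C * exp ((\<kappa> - 1) * t))"
      using cd[of t] zV[of t] V_le[of t] that by auto
    then have "(c * exp (\<kappa> * t) + d * exp (- \<kappa> * t)) * exp (- \<kappa> * t) \<le> 2 * pi * (K * exp C * exp ((\<kappa> - 1) * t)) * exp (- \<kappa> * t)"
      by (rule mult_right_mono) simp
    moreover have "(c * exp (\<kappa> * t) + d * exp (- \<kappa> * t)) * exp (- \<kappa> * t) = c + d * exp (- 2 * \<kappa> * t)"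
      by (simp add: distrib_right mult.assoc flip: exp_add)
    moreover have "2 * pi * (K * exp C * exp ((\<kappa> - 1) * t)) * exp (- \<kappa> * t) = 2 * pi * (K * exp C) * exp (- t)"
      by (simp add: mult.assoc flip: exp_add) (simp add: algebra_simps)
    ultimately show ?thesis by linarith
  qed
  then have ev: "\<forall>\<^sub>F t in at_top. c \<le> 2 * pi * (K * exp C) * exp (- t) - d * exp (- 2 * \<kappa> * t)"
    by (auto simp: eventually_at_top_linorder intro!: exI[of _ "max 0 q"])
  have "filterlim (\<lambda>t. - 2 * \<kappa> * t) at_bot at_top"
    using \<kappa> by (intro filterlim_tendsto_neg_mult_at_bot[OF tendsto_const _ filterlim_ident]) auto
  then have "((\<lambda>t. 2 * pi * (K * exp C) * exp (- t) - d * exp (- 2 * \<kappa> * t)) \<longlongrightarrow> 2 * pi * (K * exp C) * 0 - d * 0) at_top"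
    by (intro tendsto_intros filterlim_compose[OF exp_at_bot] filterlim_uminus_at_bot_at_top)
  from tendsto_lowerbound[OF this ev] c show False by simp
qed

lemma T_bounded_right: "\<exists>B. \<forall>w. Re w \<ge> 0 \<longrightarrow> norm (T w) \<le> B"
proof -
  obtain K N where "\<And>w. norm (T w) \<le> K * exp (of_nat N * \<bar>Re w\<bar>)" using T_exp_bound by blast
  from periodic_entire_dichotomy[OF T_holomorphic periodic_T this] show ?thesis
    using T_not_to_infinity by metis
qed

text \<open>\<open>T\<close> consists of a second derivative and the square of a first one, so under
  \<open>reflect\<close> it is merely composed with negation. The bound at the right end of the
  reflected solution is thus the missing bound at the left end.\<close>

lemma T_constant: "\<exists>k. \<forall>w. T w = k"
proof -
  interpret R: liouville_cylinder "\<lambda>w. u (- w)" "\<lambda>w. - a (- w)" "\<lambda>w. b (- w)" area by (rule reflect)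
  obtain B1 where B1: "\<And>w. Re w \<ge> 0 \<Longrightarrow> norm (T w) \<le> B1" using T_bounded_right by blast
  obtain B2 where B2: "\<And>w. Re w \<ge> 0 \<Longrightarrow> norm (R.T w) \<le> B2" using R.T_bounded_right by blast
  have "R.T (- w) = T w" for w by (simp add: R.T_def T_def)
  then have "norm (T w) \<le> max B1 B2" for w
    using B1[of w] B2[of "- w"] by (cases "Re w \<ge> 0") auto
  then have "bounded (range T)" unfolding bounded_iff by blast
  from Liouville_theorem[OF T_holomorphic this] show ?thesis by (auto simp: constant_on_def)
qed

end

section \<open>Classification\<close>

text \<open>The integrating factor \<open>exp (- (s * w + r * cnj w))\<close> makes both derivatives
  of the product vanish.\<close>

lemma wirtinger_exponential:
  assumes "has_wirtinger G (\<lambda>w. s * G w) (\<lambda>w. r * G w)"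
  shows "G w = G 0 * exp (s * w + r * cnj w)"
proof -
  have id: "has_wirtinger (\<lambda>w. w) (\<lambda>w. 1) (\<lambda>w. 0)"
    by (rule has_wirtinger_holomorphic) (auto intro!: derivative_eq_intros)
  have lin: "has_wirtinger (\<lambda>w. - (s * w + r * cnj w)) (\<lambda>w. - s) (\<lambda>w. - r)"
    using has_wirtinger_cmult[OF has_wirtinger_add[OF has_wirtinger_cmult[OF id, of s]
          has_wirtinger_cmult[OF has_wirtinger_cnj[OF id], of r]], of "-1"] by simp
  have "has_wirtinger (\<lambda>w. exp (- (s * w + r * cnj w))) (\<lambda>w. exp (- (s * w + r * cnj w)) * - s)
      (\<lambda>w. exp (- (s * w + r * cnj w)) * - r)"
    by (rule has_wirtinger_chain_left[OF lin]) (rule DERIV_exp)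
  from has_wirtinger_zero_constant[OF has_wirtinger_mult[OF assms this], of w 0]
  have "G w * exp (- (s * w + r * cnj w)) = G 0" by (simp add: algebra_simps)
  then have "G w * exp (- (s * w + r * cnj w)) * exp (s * w + r * cnj w) = G 0 * exp (s * w + r * cnj w)"
    by simp
  then show ?thesis by (simp add: mult.assoc flip: exp_add)
qed

section \<open>The linear system for \<open>h\<close> and its eigenfunctions\<close>

context liouville_cylinder
begin

definition hw :: "complex \<Rightarrow> complex" where
  "hw w = - (a w * of_real (h w))"

definition hww :: "complex \<Rightarrow> real" where
  "hww w = ((norm (a w))\<^sup>2 + exp (2 * u w) / 4) * h w"

lemma hww_pos: "hww w > 0"
  unfolding hww_def by (intro mult_pos_pos add_nonneg_pos h_pos) auto

text \<open>This is the Liouville equation in terms of \<open>h\<close>. Beside the linear system it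
  is the one nonlinear relation: it gives positivity in \<open>G_diagonal\<close> and ties
  \<open>A * D\<close> to \<open>B\<close> in \<open>classification\<close>.\<close>

lemma hww_h: "hww w * h w = (norm (hw w))\<^sup>2 + 1 / 4"
proof -
  have "exp (2 * u w) * (h w)\<^sup>2 = 1"
    by (simp add: h_def power2_eq_square flip: exp_add)
  then show ?thesis
    by (simp add: hww_def hw_def norm_mult power_mult_distrib algebra_simps power2_eq_square)
qed

lemma periodic_hw: "hw (w + 2 * of_real pi * \<i>) = hw w"
  by (simp add: hw_def periodic_a periodic_h)

lemma periodic_hww: "hww (w + 2 * of_real pi * \<i>) = hww w"
  by (simp add: hww_def periodic_a periodic_h periodic_u)

text \<open>For constant \<open>T\<close> the function \<open>h\<close>, its two first derivatives
  and its mixed derivative are closed under both Wirtinger derivatives, with constant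
  coefficients.\<close>

lemma linear_system:
  assumes T: "\<And>w. T w = - k2"
  shows "has_wirtinger (\<lambda>w. of_real (h w)) hw (\<lambda>w. cnj (hw w))"
    and "has_wirtinger hw (\<lambda>w. k2 * of_real (h w)) (\<lambda>w. of_real (hww w))"
    and "has_wirtinger (\<lambda>w. cnj (hw w)) (\<lambda>w. of_real (hww w)) (\<lambda>w. cnj k2 * of_real (h w))"
    and "has_wirtinger (\<lambda>w. of_real (hww w)) (\<lambda>w. k2 * cnj (hw w)) (\<lambda>w. cnj k2 * hw w)"
proof -
  show "has_wirtinger (\<lambda>w. of_real (h w)) hw (\<lambda>w. cnj (hw w))"
    using wirtinger_h by (rule has_wirtinger_cong) (simp_all add: hw_def)
  show 2: "has_wirtinger hw (\<lambda>w. k2 * of_real (h w)) (\<lambda>w. of_real (hww w))"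
    using wirtinger_hw by (rule has_wirtinger_cong) (simp_all add: hw_def hww_def T)
  show "has_wirtinger (\<lambda>w. cnj (hw w)) (\<lambda>w. of_real (hww w)) (\<lambda>w. cnj k2 * of_real (h w))"
    using has_wirtinger_cnj[OF 2] by simp
  have a2: "(a w)\<^sup>2 = b w + k2" for w
    using T[of w] by (simp add: T_def algebra_simps)
  \<comment> \<open>The mixed derivative of \<open>h\<close> contains only first derivatives of
    \<open>u\<close>, so it may be differentiated once more; the \<open>b\<close> that arises is
    eliminated by \<open>b = a\<^sup>2 - k2\<close>.\<close>
  have Q: "has_wirtinger (\<lambda>w. (a w * cnj (a w) + of_real (exp (2 * u w) / 4)) * of_real (h w))
     (\<lambda>w. k2 * cnj (hw w)) (\<lambda>w. cnj k2 * hw w)"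
  proof -
    have e: "has_wirtinger (\<lambda>w. of_real (exp (2 * u w) / 4)) (\<lambda>w. of_real (exp (2 * u w) / 2) * a w)
       (\<lambda>w. of_real (exp (2 * u w) / 2) * cnj (a w))"
      using has_wirtinger_cmult[OF wirtinger_exp_u[of 2], of "1/4"]
      by (rule has_wirtinger_cong) simp_all
    note R = has_wirtinger_mult[OF has_wirtinger_add[OF has_wirtinger_mult[OF wirtinger_a has_wirtinger_cnj[OF wirtinger_a]] e] wirtinger_h]
    have b: "b w = (a w)\<^sup>2 - k2" for w by (simp add: a2)
    show ?thesis
      by (rule has_wirtinger_cong[OF R]) (simp_all add: b hw_def algebra_simps power2_eq_square)
  qed
  then show "has_wirtinger (\<lambda>w. of_real (hww w)) (\<lambda>w. k2 * cnj (hw w)) (\<lambda>w. cnj k2 * hw w)"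
    by (rule has_wirtinger_cong) (simp_all add: hww_def flip: complex_norm_square)
qed

definition G :: "complex \<Rightarrow> complex \<Rightarrow> complex \<Rightarrow> complex" where
  "G s r w = of_real (hww w) + s * cnj (hw w) + r * hw w + s * r * of_real (h w)"

text \<open>\<open>G s r\<close> arises from \<open>h\<close> by applying \<open>d/dw + s\<close> and \<open>d/d(cnj w) + r\<close>. If \<open>s\<close> and \<open>r\<close> are square roots of
  \<open>- T\<close> and its conjugate, it is an eigenfunction of both derivatives.\<close>

lemma G_exponential:
  assumes T: "\<And>w. T w = - k2" and s: "s\<^sup>2 = k2" and r: "r\<^sup>2 = cnj k2"
  shows "G s r w = G s r 0 * exp (s * w + r * cnj w)"
proof (rule wirtinger_exponential)
  note S = linear_system[OF T]
  show "has_wirtinger (G s r) (\<lambda>w. s * G s r w) (\<lambda>w. r * G s r w)"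
    unfolding G_def[abs_def]
    by (rule has_wirtinger_cong[OF has_wirtinger_add[OF has_wirtinger_add[OF has_wirtinger_add[OF
            S(4) has_wirtinger_cmult[OF S(3), of s]] has_wirtinger_cmult[OF S(2), of r]] has_wirtinger_cmult[OF S(1), of "s * r"]]])
       (unfold r[symmetric], unfold s[symmetric], simp_all add: algebra_simps power2_eq_square)
qed

lemma G_periodic: "G s r (w + 2 * of_real pi * \<i>) = G s r w"
  by (simp add: G_def periodic_h periodic_hw periodic_hww)

text \<open>By \<open>hww_h\<close>, multiplication by \<open>h w\<close> turns the expression into
  \<open>1 / 4\<close> plus the squared modulus of \<open>hw w + s * h w\<close>.\<close>

lemma G_diagonal: "\<exists>x>0. G s (cnj s) w = of_real x"
proof -
  have "G s (cnj s) w * of_real (h w) = of_real (1 / 4 + (norm (hw w + s * of_real (h w)))\<^sup>2)"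
  proof -
    have "of_real (hww w) * of_real (h w) = hw w * cnj (hw w) + 1 / 4"
      unfolding of_real_mult[symmetric] hww_h by (simp flip: complex_norm_square)
    moreover have "of_real ((norm (hw w + s * of_real (h w)))\<^sup>2) = (hw w + s * of_real (h w)) * cnj (hw w + s * of_real (h w))"
      by (rule complex_norm_square)
    ultimately show ?thesis by (simp add: G_def algebra_simps)
  qed
  then have "G s (cnj s) w = of_real ((1 / 4 + (norm (hw w + s * of_real (h w)))\<^sup>2) / h w)"
    using h_pos[of w] by (simp add: field_simps)
  moreover have "(1 / 4 + (norm (hw w + s * of_real (h w)))\<^sup>2) / h w > 0"
    using h_pos[of w] by (intro divide_pos_pos add_pos_nonneg) auto
  ultimately show ?thesis by blast
qed

text \<open>For \<open>T = 0\<close> the mixed derivative \<open>hww\<close> is constant and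
  \<open>hw\<close> is affine in \<open>cnj w\<close> with that slope. Periodicity makes the slope
  vanish, against \<open>hww_pos\<close>.\<close>

lemma T_nonzero: "\<not> (\<forall>w. T w = 0)"
proof
  assume "\<forall>w. T w = 0"
  then have T: "T w = - 0" for w by simp
  note S = linear_system[OF T]
  have hww: "hww w = hww 0" for w
    using has_wirtinger_zero_constant[OF S(4), of w 0] by simp
  have id: "has_wirtinger (\<lambda>w. w) (\<lambda>w. 1) (\<lambda>w. 0)"
    by (rule has_wirtinger_holomorphic) (auto intro!: derivative_eq_intros)
  have "hw w - hww 0 * cnj w = hw z - hww 0 * cnj z" for w z
    by (rule has_wirtinger_zero_constant[OF has_wirtinger_diff[OF S(2) has_wirtinger_cmult[OF has_wirtinger_cnj[OF id]]]])
       (simp_all, rule hww)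
  from this[of "0 + 2 * of_real pi * \<i>" 0] periodic_hw[of 0] have "hww 0 = 0" by simp
  with hww_pos[of 0] show False by simp
qed

text \<open>The eigenfunctions \<open>G\<close> for the four sign choices are exponentials
  determined by their values at \<open>0\<close>, and \<open>h\<close> is a linear combination of
  them. \<open>A\<close> and \<open>D\<close> belong to equal signs, \<open>B\<close> and its
  conjugate to opposite signs.\<close>

lemma classification:
  "\<exists>\<alpha> A D B. \<alpha> > 0 \<and> A > 0 \<and> D > 0 \<and> A * D = \<alpha>\<^sup>2 / 4 + (norm B)\<^sup>2 \<and> (B = 0 \<or> \<alpha> \<in> \<int>) \<and>
     (\<forall>w. \<alpha>\<^sup>2 * h w = A * exp (\<alpha> * Re w) + D * exp (- \<alpha> * Re w) - 2 * Re (B * cis (\<alpha> * Im w)))"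
proof -
  obtain k where k: "\<And>w. T w = k" using T_constant by blast
  define \<kappa> where "\<kappa> = csqrt (- k)"
  have T: "T w = - (\<kappa>\<^sup>2)" for w by (simp add: \<kappa>_def k)
  have "k \<noteq> 0" using T_nonzero k by auto
  then have \<kappa>0: "\<kappa> \<noteq> 0" by (simp add: \<kappa>_def)
  have Re: "Re \<kappa> \<ge> 0" unfolding \<kappa>_def using csqrt_principal[of "- k"] by auto
  obtain A where A: "A > 0" "G \<kappa> (cnj \<kappa>) 0 = of_real A" using G_diagonal by blast
  obtain D where D: "D > 0" "G (- \<kappa>) (cnj (- \<kappa>)) 0 = of_real D" using G_diagonal by blast
  have "Im \<kappa> = 0"
  proof -
    \<comment> \<open>A period multiplies this eigenfunction by a factor of modulus
      \<open>exp (- 4 * pi * Im \<kappa>)\<close>, which must be \<open>1\<close> since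
      \<open>A\<close> is nonzero.\<close>
    have "G \<kappa> (cnj \<kappa>) (0 + 2 * of_real pi * \<i>) = G \<kappa> (cnj \<kappa>) 0 * exp (\<kappa> * (2 * pi * \<i>) + cnj \<kappa> * cnj (2 * pi * \<i>))"
      using G_exponential[OF T refl, of "cnj \<kappa>" "2 * pi * \<i>"] by simp
    then have "exp (\<kappa> * (2 * pi * \<i>) + cnj \<kappa> * cnj (2 * pi * \<i>)) = 1"
      unfolding G_periodic using A by simp
    then have "norm (exp (\<kappa> * (2 * pi * \<i>) + cnj \<kappa> * cnj (2 * pi * \<i>))) = 1" by simp
    then show ?thesis by (simp add: norm_exp_eq_Re)
  qed
  define \<rho> where "\<rho> = Re \<kappa>"
  have \<kappa>: "\<kappa> = of_real \<rho>" using \<open>Im \<kappa> = 0\<close> by (simp add: \<rho>_def complex_eq_iff)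
  have \<rho>: "\<rho> > 0" 
  proof -
    have "\<rho> \<noteq> 0" using \<kappa>0 \<kappa> by auto
    with Re show ?thesis unfolding \<rho>_def[symmetric] by simp
  qed
  define \<alpha> where "\<alpha> = 2 * \<rho>"
  define B where "B = G \<rho> (- \<rho>) 0"
  have G1: "G \<rho> \<rho> w = of_real (A * exp (\<alpha> * Re w))" for w
  proof -
    have "of_real \<rho> * w + of_real \<rho> * cnj w = of_real (\<alpha> * Re w)" by (rule complex_eqI) (simp_all add: \<alpha>_def)
    moreover have "G \<rho> \<rho> w = G \<rho> \<rho> 0 * exp (of_real \<rho> * w + of_real \<rho> * cnj w)"
      by (rule G_exponential[OF T]) (simp_all add: \<kappa>)
    ultimately show ?thesis using A(2) unfolding \<kappa> by (simp only: complex_cnj_complex_of_real exp_of_real) simp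
  qed
  have G4: "G (- \<rho>) (- \<rho>) w = of_real (D * exp (- \<alpha> * Re w))" for w
  proof -
    have "- of_real \<rho> * w + - of_real \<rho> * cnj w = of_real (- \<alpha> * Re w)" by (rule complex_eqI) (simp_all add: \<alpha>_def)
    moreover have "G (- \<rho>) (- \<rho>) w = G (- \<rho>) (- \<rho>) 0 * exp (- of_real \<rho> * w + - of_real \<rho> * cnj w)"
      unfolding of_real_minus by (rule G_exponential[OF T]) (simp_all add: \<kappa>)
    ultimately show ?thesis using D(2) unfolding \<kappa>
      by (simp only: complex_cnj_minus complex_cnj_complex_of_real exp_of_real) simp
  qed
  have G2: "G \<rho> (- \<rho>) w = B * cis (\<alpha> * Im w)" for w
  proof -
    have "of_real \<rho> * w + - of_real \<rho> * cnj w = \<i> * of_real (\<alpha> * Im w)" by (rule complex_eqI) (simp_all add: \<alpha>_def)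
    moreover have "G \<rho> (- \<rho>) w = B * exp (of_real \<rho> * w + - of_real \<rho> * cnj w)"
      unfolding B_def of_real_minus by (rule G_exponential[OF T]) (simp_all add: \<kappa>)
    ultimately show ?thesis by (simp only: cis_conv_exp)
  qed
  have G3: "G (- \<rho>) \<rho> w = cnj (G \<rho> (- \<rho>) w)" for w
    by (simp add: G_def)
  have "\<alpha>\<^sup>2 * h w = A * exp (\<alpha> * Re w) + D * exp (- \<alpha> * Re w) - 2 * Re (B * cis (\<alpha> * Im w))" for w
  proof -
    \<comment> \<open>With these signs only the \<open>s * r * h\<close> terms survive; they add up
      to \<open>4 * \<rho>\<^sup>2 * h w\<close>.\<close>
    have "of_real (\<alpha>\<^sup>2 * h w) = G \<rho> \<rho> w + G (- \<rho>) (- \<rho>) w - (G \<rho> (- \<rho>) w + G (- \<rho>) \<rho> w)"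
      by (simp add: G_def \<alpha>_def power2_eq_square algebra_simps)
    also have "\<dots> = of_real (A * exp (\<alpha> * Re w)) + of_real (D * exp (- \<alpha> * Re w)) - of_real (2 * Re (B * cis (\<alpha> * Im w)))"
      unfolding G1 G4 G3 complex_add_cnj G2 ..
    also have "\<dots> = of_real (A * exp (\<alpha> * Re w) + D * exp (- \<alpha> * Re w) - 2 * Re (B * cis (\<alpha> * Im w)))"
      by simp
    finally show ?thesis by (simp only: of_real_eq_iff)
  qed
  moreover have "A * D = \<alpha>\<^sup>2 / 4 + (norm B)\<^sup>2"
  proof -
    \<comment> \<open>The determinant \<open>G \<rho> \<rho> * G (- \<rho>) (- \<rho>) - G \<rho> (-
      \<rho>) * G (- \<rho>) \<rho>\<close> equals
      \<open>4 * \<rho>\<^sup>2 * (hww * h - \<bar>hw\<bar>\<^sup>2)\<close>, and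
      \<open>hww_h\<close> evaluates it to \<open>\<rho>\<^sup>2\<close>.\<close>
    have "complex_of_real (A * D) = G \<rho> \<rho> 0 * G (- \<rho>) (- \<rho>) 0"
      using G1[of 0] G4[of 0] by simp
    also have "\<dots> = 4 * of_real (\<rho>\<^sup>2) * (of_real (hww 0 * h 0) - hw 0 * cnj (hw 0)) + G \<rho> (- \<rho>) 0 * G (- \<rho>) \<rho> 0"
      by (simp add: G_def power2_eq_square algebra_simps)
    also have "\<dots> = of_real (\<alpha>\<^sup>2 / 4 + (norm B)\<^sup>2)"
      unfolding G3 B_def[symmetric] hww_h complex_norm_square[symmetric]
      by (simp add: \<alpha>_def power_mult_distrib)
    finally show ?thesis by (simp only: of_real_eq_iff)
  qed
  moreover have "B = 0 \<or> \<alpha> \<in> \<int>"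
  proof (cases "B = 0")
    case False
    have "B * cis (\<alpha> * (2 * pi)) = B"
      using G_periodic[of \<rho> "- \<rho>" 0] G2[of "0 + 2 * of_real pi * \<i>"] G2[of 0] by simp
    with False have "exp (\<i> * of_real (\<alpha> * (2 * pi))) = 1" by (simp add: cis_conv_exp)
    then obtain n :: int where "\<alpha> * (2 * pi) = of_int (2 * n) * pi" by (auto simp: exp_eq_1)
    then have "\<alpha> = of_int n" by simp
    then show ?thesis by simp
  qed simp
  ultimately show ?thesis using \<rho> A D by (intro exI[of _ \<alpha>] exI[of _ A] exI[of _ D] exI[of _ B]) (auto simp: \<alpha>_def)
qed

end

section \<open>Passage to the cylinder\<close>

text \<open>Writing \<open>g x d - g x y\<close> as the integral of \<open>gy x\<close> and
  differentiating under the integral sign shows that \<open>gxy x\<close> and \<open>gyx x\<close>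
  have equal integrals over every \<open>[y, d]\<close>. The derivative at the left endpoint gives
  equality of the integrands.\<close>

lemma mixed_partials:
  fixes g gx gy gxy gyx :: "real \<Rightarrow> real \<Rightarrow> real"
  assumes gx: "\<And>x y. ((\<lambda>x. g x y) has_real_derivative gx x y) (at x)"
    and gy: "\<And>x y. (g x has_real_derivative gy x y) (at y)"
    and gxy: "\<And>x y. (gx x has_real_derivative gxy x y) (at y)"
    and gyx: "\<And>x y. ((\<lambda>x. gy x y) has_real_derivative gyx x y) (at x)"
    and cy: "\<And>x. continuous_on UNIV (gy x)"
    and cont: "continuous_on UNIV (\<lambda>(x, y). gxy x y)" "continuous_on UNIV (\<lambda>(x, y). gyx x y)"
  shows "gxy x y = gyx x y"
proof -
  have cxy: "continuous_on S (gxy x)" and cyx: "continuous_on S (gyx x)" for S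
    using continuous_on_compose2[OF cont(1) continuous_on_Pair[OF continuous_on_const[of S x] continuous_on_id]]
      continuous_on_compose2[OF cont(2) continuous_on_Pair[OF continuous_on_const[of S x] continuous_on_id]]
    by auto
  have 1: "((\<lambda>d. integral {y..d} (\<lambda>s. gxy x s - gyx x s)) has_vector_derivative gxy x y - gyx x y) (at y within {y..y + 1})"
    by (rule integral_has_vector_derivative) (auto intro!: continuous_intros cxy cyx)
  have zero: "integral {y..d} (\<lambda>s. gxy x s - gyx x s) = 0" if "d \<ge> y" for d
  proof -
    have g: "integral {y..d} (gy x') = g x' d - g x' y" for x'
      using gy that by (intro integral_unique fundamental_theorem_of_calculus)
        (simp_all add: has_real_derivative_iff_has_vector_derivative has_vector_derivative_at_within)
    have "((\<lambda>x. integral (cbox y d) (gy x)) has_vector_derivative integral (cbox y d) (gyx x)) (at x within UNIV)"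
      using gyx cont(2) continuous_on_subset[OF cy]
      by (intro leibniz_rule_vector_derivative)
         (auto simp: has_real_derivative_iff_has_vector_derivative intro!: integrable_continuous_real continuous_on_subset[OF cont(2)])
    then have "((\<lambda>x. g x d - g x y) has_vector_derivative integral {y..d} (gyx x)) (at x)"
      by (simp add: g)
    moreover have "((\<lambda>x. g x d - g x y) has_vector_derivative gx x d - gx x y) (at x)"
      using gx by (intro has_vector_derivative_diff) (simp_all add: has_real_derivative_iff_has_vector_derivative)
    ultimately have "integral {y..d} (gyx x) = gx x d - gx x y"
      by (rule vector_derivative_unique_at)
    moreover have "integral {y..d} (gxy x) = gx x d - gx x y"
      using gxy that by (intro integral_unique fundamental_theorem_of_calculus)
        (simp_all add: has_real_derivative_iff_has_vector_derivative has_vector_derivative_at_within)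
    ultimately show ?thesis
      by (subst integral_diff) (auto intro!: integrable_continuous_real cxy cyx)
  qed
  have "((\<lambda>d. 0) has_vector_derivative gxy x y - gyx x y) (at y within {y..y + 1})"
    by (rule has_vector_derivative_transform[OF _ _ 1]) (auto simp: zero)
  then show ?thesis
    using vector_derivative_unique_within_closed_interval[of y "y + 1" y "\<lambda>d. 0" "gxy x y - gyx x y" 0]
    by simp
qed

text \<open>The arguments of \<open>U\<close> are (\<theta>, t), whereas
  \<open>w = t + \<i> * \<theta>\<close>; hence the order \<open>(Im w, Re w)\<close>, with
  \<open>x\<close> standing for \<theta> and \<open>y\<close> for \<open>t\<close>, and
  \<open>a = (Uy - \<i> * Ux) / 2\<close>.\<close>

lemma planar_C2_wirtinger:
  fixes U :: "real \<times> real \<Rightarrow> real"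
  assumes "C2 U"
  obtains a b Uxx Uyy where
    "has_wirtinger (\<lambda>w. of_real (U (Im w, Re w))) a (\<lambda>w. cnj (a w))"
    "has_wirtinger a b (\<lambda>w. of_real ((Uxx (Im w, Re w) + Uyy (Im w, Re w)) / 4))"
    "continuous_on UNIV b"
    "\<And>x y. deriv (deriv (\<lambda>x. U (x, y))) x = Uxx (x, y)"
    "\<And>x y. deriv (deriv (\<lambda>y. U (x, y))) y = Uyy (x, y)"
proof -
  obtain f' :: "real \<times> real \<Rightarrow> (real \<times> real) \<Rightarrow>\<^sub>L real" and f'' :: "real \<times> real \<Rightarrow> (real \<times> real) \<Rightarrow>\<^sub>L ((real \<times> real) \<Rightarrow>\<^sub>L real)"
    where f': "\<And>p. (U has_derivative blinfun_apply (f' p)) (at p)"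
      and f'': "\<And>p. (f' has_derivative blinfun_apply (f'' p)) (at p)"
      and cf'': "continuous_on UNIV f''"
    using assms unfolding C2_def by blast
  define Ux where "Ux = (\<lambda>p. f' p (1, 0))"
  define Uy where "Uy = (\<lambda>p. f' p (0, 1))"
  define Uxx where "Uxx = (\<lambda>p. f'' p (1, 0) (1, 0))"
  define Uyx where "Uyx = (\<lambda>p. f'' p (1, 0) (0, 1))"
  define Uxy where "Uxy = (\<lambda>p. f'' p (0, 1) (1, 0))"
  define Uyy where "Uyy = (\<lambda>p. f'' p (0, 1) (0, 1))"
  have split: "(d :: real \<times> real) = fst d *\<^sub>R (1, 0) + snd d *\<^sub>R (0, 1)" for d by (simp add: prod_eq_iff)
  have D: "(U has_derivative (\<lambda>d. fst d * Ux p + snd d * Uy p)) (at p)" for p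
  proof -
    have "f' p (fst d *\<^sub>R (1, 0) + snd d *\<^sub>R (0, 1)) = fst d * Ux p + snd d * Uy p" for d
      by (simp only: blinfun.bilinear_simps Ux_def Uy_def real_scaleR_def)
    then have "f' p d = fst d * Ux p + snd d * Uy p" for d
      by (simp only: split[symmetric])
    then have "blinfun_apply (f' p) = (\<lambda>d. fst d * Ux p + snd d * Uy p)" by blast
    with f'[of p] show ?thesis by simp
  qed
  have D2: "((\<lambda>p. f' p e) has_derivative (\<lambda>d. fst d * f'' p (1, 0) e + snd d * f'' p (0, 1) e)) (at p)" for p e
  proof -
    have "f'' p d e = fst d * f'' p (1, 0) e + snd d * f'' p (0, 1) e" for d
    proof -
      have "f'' p (fst d *\<^sub>R (1, 0) + snd d *\<^sub>R (0, 1)) e = fst d * f'' p (1, 0) e + snd d * f'' p (0, 1) e"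
        by (simp only: blinfun.bilinear_simps real_scaleR_def)
      then show ?thesis unfolding split[symmetric, of d] .
    qed
    then have eq: "(\<lambda>d. f'' p d e) = (\<lambda>d. fst d * f'' p (1, 0) e + snd d * f'' p (0, 1) e)" by blast
    show ?thesis
      unfolding eq[symmetric] by (rule bounded_linear.has_derivative[OF blinfun.bounded_linear_left f''])
  qed
  have Dx: "(Ux has_derivative (\<lambda>d. fst d * Uxx p + snd d * Uxy p)) (at p)"
    and Dy: "(Uy has_derivative (\<lambda>d. fst d * Uyx p + snd d * Uyy p)) (at p)" for p
    using D2[of _ p] unfolding Ux_def Uy_def Uxx_def Uxy_def Uyx_def Uyy_def by auto
  have cont: "continuous_on UNIV Uxx" "continuous_on UNIV Uxy" "continuous_on UNIV Uyx" "continuous_on UNIV Uyy"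
    unfolding Uxx_def Uxy_def Uyx_def Uyy_def by (intro continuous_intros cf'')+
  have px: "((\<lambda>x. F (x, y)) has_real_derivative A) (at x)"
    and py: "((\<lambda>y. F (x, y)) has_real_derivative B) (at y)"
    if "(F has_derivative (\<lambda>d. fst d * A + snd d * B)) (at (x, y))" for F :: "real \<times> real \<Rightarrow> real" and A B x y
  proof -
    have "((\<lambda>x. (x, y)) has_derivative (\<lambda>d. (d, 0))) (at x)" "((\<lambda>y. (x, y)) has_derivative (\<lambda>d. (0, d))) (at y)"
      by (auto intro!: derivative_eq_intros)
    from has_derivative_compose[OF this(1) that] has_derivative_compose[OF this(2) that]
    show "((\<lambda>x. F (x, y)) has_real_derivative A) (at x)" "((\<lambda>y. F (x, y)) has_real_derivative B) (at y)"
      by (simp_all add: has_derivative_imp_has_field_derivative)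
  qed
  have cUy: "continuous_on UNIV Uy"
    using Dy has_derivative_continuous continuous_at_imp_continuous_on by blast
  \<comment> \<open>The imaginary part of the \<open>cnj w\<close>-derivative of \<open>a\<close> is
    a multiple of the difference of the mixed partials; symmetry leaves a quarter of the
    Laplacian.\<close>
  have sym: "Uxy p = Uyx p" for p
  proof -
    have "Uxy (x, y) = Uyx (x, y)" for x y
      by (rule mixed_partials[where g = "\<lambda>x y. U (x, y)" and gx = "\<lambda>x y. Ux (x, y)" and gy = "\<lambda>x y. Uy (x, y)"
            and gxy = "\<lambda>x y. Uxy (x, y)" and gyx = "\<lambda>x y. Uyx (x, y)"])
         (auto intro!: px[OF D] py[OF D] py[OF Dx] px[OF Dy] continuous_on_compose2[OF cUy] continuous_intros cont simp: cont)
    then show ?thesis by (cases p) auto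
  qed
  let ?P = "\<lambda>w :: complex. (Im w, Re w)"
  define a where "a = (\<lambda>w. Complex (Uy (?P w) / 2) (- Ux (?P w) / 2))"
  define b where "b = (\<lambda>w. Complex ((Uyy (?P w) - Uxx (?P w)) / 4) (- Uyx (?P w) / 2))"
  have PD: "(?P has_derivative ?P) (at w)" for w by (auto intro!: derivative_eq_intros)
  show thesis
  proof (rule that)
    show "has_wirtinger (\<lambda>w. of_real (U (?P w))) a (\<lambda>w. cnj (a w))"
      unfolding has_wirtinger_def
    proof
      fix w
      have *: "((\<lambda>w. U (?P w)) has_derivative (\<lambda>d. Im d * Ux (?P w) + Re d * Uy (?P w))) (at w)"
        using has_derivative_compose[OF PD D] by simp
      show "((\<lambda>w. complex_of_real (U (?P w))) has_derivative (\<lambda>d. a w * d + cnj (a w) * cnj d)) (at w)"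
        by (rule has_derivative_eq_rhs[OF has_derivative_of_real[OF *]])
           (auto simp: fun_eq_iff complex_eq_iff a_def)
    qed
    show "has_wirtinger a b (\<lambda>w. of_real ((Uxx (?P w) + Uyy (?P w)) / 4))"
      unfolding has_wirtinger_def
    proof
      fix w
      have 1: "((\<lambda>w. Uy (?P w)) has_derivative (\<lambda>d. Im d * Uyx (?P w) + Re d * Uyy (?P w))) (at w)"
        using has_derivative_compose[OF PD Dy] by simp
      have 2: "((\<lambda>w. Ux (?P w)) has_derivative (\<lambda>d. Im d * Uxx (?P w) + Re d * Uyx (?P w))) (at w)"
        using has_derivative_compose[OF PD Dx] by (simp add: sym)
      have a: "a = (\<lambda>w. of_real (Uy (?P w)) * (1 / 2) - \<i> * of_real (Ux (?P w)) * (1 / 2))"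
        by (auto simp: fun_eq_iff complex_eq_iff a_def)
      have "(a has_derivative
          (\<lambda>d. of_real (Im d * Uyx (?P w) + Re d * Uyy (?P w)) * (1 / 2) - \<i> * of_real (Im d * Uxx (?P w) + Re d * Uyx (?P w)) * (1 / 2))) (at w)"
        unfolding a
        by (intro has_derivative_diff has_derivative_mult_left has_derivative_mult_right has_derivative_of_real 1 2)
      then show "(a has_derivative (\<lambda>d. b w * d + of_real ((Uxx (?P w) + Uyy (?P w)) / 4) * cnj d)) (at w)"
        by (rule has_derivative_eq_rhs) (auto simp: fun_eq_iff complex_eq_iff b_def field_simps)
    qed
    have cP: "continuous_on UNIV ?P" by (intro continuous_intros)
    show "continuous_on UNIV b"
      unfolding b_def Complex_eq
      by (intro continuous_intros continuous_on_compose2[OF cont(1) cP] continuous_on_compose2[OF cont(3) cP] continuous_on_compose2[OF cont(4) cP]) auto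
    show "deriv (deriv (\<lambda>x. U (x, y))) x = Uxx (x, y)" for x y
    proof -
      have "deriv (\<lambda>x. U (x, y)) = (\<lambda>x. Ux (x, y))" using DERIV_imp_deriv[OF px[OF D]] by blast
      then show ?thesis using DERIV_imp_deriv[OF px[OF Dx]] by simp
    qed
    show "deriv (deriv (\<lambda>y. U (x, y))) y = Uyy (x, y)" for x y
    proof -
      have "deriv (\<lambda>y. U (x, y)) = (\<lambda>y. Uy (x, y))" using DERIV_imp_deriv[OF py[OF D]] by blast
      then show ?thesis using DERIV_imp_deriv[OF py[OF Dy]] by simp
    qed
  qed
qed

section \<open>The area measure and iterated integrals\<close>

lemma measurable_arg:
  "(\<lambda>z. if z \<in> \<real>\<^sub>\<le>\<^sub>0 then pi else Arg z) \<in> borel_measurable borel"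
  by (rule borel_measurable_continuous_on_if) (auto intro!: continuous_intros continuous_on_Arg borel_closed)

text \<open>This gives a Borel right inverse of \<open>cis\<close> on the unit circle: the closed
  cut where \<open>Arg\<close> is replaced meets the circle only in \<open>- 1\<close>, for which
  \<open>pi\<close> is the correct angle.\<close>

lemma cis_measurable_arg:
  assumes "z \<in> sphere 0 1"
  shows "cis (if z \<in> \<real>\<^sub>\<le>\<^sub>0 then pi else Arg z) = z"
proof (cases "z \<in> \<real>\<^sub>\<le>\<^sub>0")
  case True
  then have "z = of_real (Re z)" "Re z \<le> 0" by (auto simp: complex_nonpos_Reals_iff complex_eq_iff)
  with assms have "z = - 1" by (metis abs_of_nonpos add.inverse_inverse dist_0_norm mem_sphere norm_of_real of_real_1 of_real_minus)
  with True show ?thesis by simp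
next
  case False
  moreover have "z \<noteq> 0" using assms by auto
  ultimately show ?thesis using cis_Arg[of z] assms by (simp add: sgn_div_norm)
qed

text \<open>Continuity is given for \<open>cyl_lift u\<close> only, so measurability of
  \<open>u\<close> has to be derived: on the circle times the line, \<open>u\<close> is
  \<open>cyl_lift u\<close> composed with the Borel angle. Off the cylinder \<open>u\<close> is
  arbitrary, but the restricted measure space does not contain those points.\<close>

lemma cyl_area_nn_integral:
  fixes u :: "complex \<times> real \<Rightarrow> real"
  assumes cont: "continuous_on UNIV (cyl_lift u)"
  shows "(\<integral>\<^sup>+ p. ennreal (exp (2 * u p)) \<partial>cyl_area) =
    (\<integral>\<^sup>+ \<theta>. (\<integral>\<^sup>+ t. ennreal (exp (2 * cyl_lift u (\<theta>, t))) \<partial>lborel) * indicator {0..<2 * pi} \<theta> \<partial>lborel)"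
proof -
  let ?S = "restrict_space borel (sphere 0 1 :: complex set)"
  let ?f = "\<lambda>p. ennreal (exp (2 * u p))"
  let ?arg = "\<lambda>z. if z \<in> \<real>\<^sub>\<le>\<^sub>0 then pi else Arg z"
  have cis: "cis \<in> measurable (restrict_space lborel {0..<2 * pi}) ?S"
  proof (rule measurable_restrict_space2)
    show "cis \<in> measurable (restrict_space lborel {0..<2 * pi}) borel"
    proof (rule measurable_restrict_space1)
      have "continuous_on UNIV (\<lambda>x. cis x)" by (intro continuous_intros)
      from borel_measurable_continuous_onI[OF this] show "cis \<in> borel_measurable lborel" by simp
    qed
  qed auto
  have sets: "sets arc_length = sets ?S" by (simp add: arc_length_def)
  have "(\<lambda>p. u p) \<in> borel_measurable (?S \<Otimes>\<^sub>M lborel)"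
  proof -
    have "(\<lambda>p. cyl_lift u (?arg (fst p), snd p)) \<in> borel_measurable (?S \<Otimes>\<^sub>M lborel)"
    proof (rule measurable_compose[where N = "borel \<Otimes>\<^sub>M borel"])
      have "?arg \<in> borel_measurable ?S" by (rule measurable_restrict_space1[OF measurable_arg])
      from measurable_compose[OF measurable_fst this]
      show "(\<lambda>p. (?arg (fst p), snd p)) \<in> measurable (?S \<Otimes>\<^sub>M lborel) (borel \<Otimes>\<^sub>M borel)"
        by (intro measurable_Pair) (auto simp: o_def)
      show "cyl_lift u \<in> borel_measurable (borel \<Otimes>\<^sub>M borel)"
        using borel_measurable_continuous_onI[OF cont] by (simp add: borel_prod)
    qed
    then show ?thesis
    proof (rule measurable_cong[THEN iffD1, rotated])
      fix p :: "complex \<times> real" assume "p \<in> space (?S \<Otimes>\<^sub>M lborel)"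
      then have "fst p \<in> sphere 0 1" by (auto simp: space_pair_measure space_restrict_space)
      from cis_measurable_arg[OF this] show "cyl_lift u (?arg (fst p), snd p) = u p"
        by (simp only: cyl_lift_def case_prod_conv prod.collapse)
    qed
  qed
  then have f: "?f \<in> borel_measurable (?S \<Otimes>\<^sub>M lborel)" by measurable
  then have f': "?f \<in> borel_measurable (arc_length \<Otimes>\<^sub>M lborel)"
    using measurable_cong_sets[OF sets_pair_measure_cong[OF sets refl] refl] by blast
  have "(\<integral>\<^sup>+ p. ?f p \<partial>cyl_area) = (\<integral>\<^sup>+ w. \<integral>\<^sup>+ t. ?f (w, t) \<partial>lborel \<partial>arc_length)"
    unfolding cyl_area_def by (rule lborel.nn_integral_fst[OF f', symmetric])
  also have "\<dots> = (\<integral>\<^sup>+ \<theta>. \<integral>\<^sup>+ t. ?f (cis \<theta>, t) \<partial>lborel \<partial>restrict_space lborel {0..<2 * pi})"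
    unfolding arc_length_def
    by (rule nn_integral_distr[OF cis]) (use lborel.borel_measurable_nn_integral_fst[OF f] in simp)
  also have "\<dots> = (\<integral>\<^sup>+ \<theta>. (\<integral>\<^sup>+ t. ?f (cis \<theta>, t) \<partial>lborel) * indicator {0..<2 * pi} \<theta> \<partial>lborel)"
    by (rule nn_integral_restrict_space) simp
  finally show ?thesis by (simp add: cyl_lift_def)
qed

lemma cyl_area_bounds_integral:
  fixes u :: "complex \<times> real \<Rightarrow> real"
  assumes cont: "continuous_on UNIV (cyl_lift u)"
    and fin: "(\<integral>\<^sup>+ p. ennreal (exp (2 * u p)) \<partial>cyl_area) < \<infinity>"
  shows "\<exists>K. \<forall>R. integral {-R..R} (\<lambda>t. integral {0..2*pi} (\<lambda>\<theta>. exp (2 * cyl_lift u (\<theta>, t)))) \<le> K"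
proof -
  define I where "I = (\<integral>\<^sup>+ p. ennreal (exp (2 * u p)) \<partial>cyl_area)"
  let ?g = "\<lambda>\<theta> t. exp (2 * cyl_lift u (\<theta>, t))"
  have cg: "continuous_on S (\<lambda>x. ?g (k x) (l x))" if "continuous_on S k" "continuous_on S l"
    for S :: "'z::topological_space set" and k l
    by (intro continuous_intros continuous_on_compose2[OF cont] that) auto
  have "integral {-R..R} (\<lambda>t. integral {0..2*pi} (\<lambda>\<theta>. ?g \<theta> t)) \<le> enn2real I" for R
  proof -
    define m where "m = (\<lambda>\<theta>. integral {-R..R} (?g \<theta>))"
    have m0: "m \<theta> \<ge> 0" for \<theta>
      unfolding m_def by (intro integral_nonneg integrable_continuous_real cg continuous_intros) auto
    have m_le: "ennreal (m \<theta>) \<le> (\<integral>\<^sup>+ t. ennreal (?g \<theta> t) \<partial>lborel)" for \<theta>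
    proof -
      have "(?g \<theta> has_integral m \<theta>) {-R..R}"
        unfolding m_def by (intro integrable_integral integrable_continuous_real cg continuous_intros)
      from nn_integral_has_integral_lebesgue'[OF _ this]
      have "ennreal (m \<theta>) = (\<integral>\<^sup>+ t. ennreal (?g \<theta> t) * indicator {-R..R} t \<partial>lborel)" by simp
      also have "\<dots> \<le> (\<integral>\<^sup>+ t. ennreal (?g \<theta> t) \<partial>lborel)"
        by (intro nn_integral_mono) (auto simp: indicator_def)
      finally show ?thesis .
    qed
    have cm: "continuous_on S m" for S
      unfolding m_def cbox_interval[symmetric]
      by (rule integral_continuous_on_param) (auto intro!: continuous_intros continuous_on_subset[OF cont] continuous_on_compose2[OF cont] simp: split_beta)
    have "integral {-R..R} (\<lambda>t. integral {0..2*pi} (\<lambda>\<theta>. ?g \<theta> t)) = integral {0..2*pi} m"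
      unfolding m_def cbox_interval[symmetric]
      by (rule integral_swap_continuous) (auto intro!: continuous_intros continuous_on_subset[OF cont] continuous_on_compose2[OF cont] simp: split_beta)
    moreover have "ennreal (integral {0..2*pi} m) \<le> I"
    proof -
      have "(m has_integral integral {0..2*pi} m) {0..2*pi}"
        by (intro integrable_integral integrable_continuous_real cm)
      from nn_integral_has_integral_lebesgue'[OF _ this] m0
      have "ennreal (integral {0..2*pi} m) = (\<integral>\<^sup>+ \<theta>. ennreal (m \<theta>) * indicator {0..2*pi} \<theta> \<partial>lborel)" by simp
      \<comment> \<open>The closed and the half-open interval differ by the null set
        \<open>{2 * pi}\<close>.\<close>
      also have "\<dots> = (\<integral>\<^sup>+ \<theta>. ennreal (m \<theta>) * indicator {0..<2*pi} \<theta> \<partial>lborel)"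
        using AE_lborel_singleton[of "2 * pi"]
        by (intro nn_integral_cong_AE) (auto elim!: eventually_mono simp: indicator_def)
      also have "\<dots> \<le> (\<integral>\<^sup>+ \<theta>. (\<integral>\<^sup>+ t. ennreal (?g \<theta> t) \<partial>lborel) * indicator {0..<2 * pi} \<theta> \<partial>lborel)"
        by (intro nn_integral_mono mult_right_mono m_le) auto
      also have "\<dots> = I" unfolding I_def cyl_area_nn_integral[OF cont] ..
      finally show ?thesis .
    qed
    ultimately show ?thesis
      using fin unfolding I_def[symmetric]
      by (metis enn2real_mono enn2real_ennreal integral_nonneg[OF integrable_continuous_real[OF cm] m0] infinity_ennreal_def)
  qed
  then show ?thesis by blast
qed

lemma cyl_lift_liouville:
  fixes u :: "complex \<times> real \<Rightarrow> real"
  assumes regular: "C2 (cyl_lift u)"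
    and solution: "\<forall>p\<in>cylinder. cyl_laplacian u p + exp (2 * u p) = 0"
    and finite_total_curvature: "(\<integral>\<^sup>+ p. ennreal (exp (2 * u p)) \<partial>cyl_area) < \<infinity>"
  shows "\<exists>a b K. liouville_cylinder (\<lambda>w. u (cis (Im w), Re w)) a b K"
proof -
  let ?U = "cyl_lift u"
  obtain a b Uxx Uyy where W: "has_wirtinger (\<lambda>w. of_real (?U (Im w, Re w))) a (\<lambda>w. cnj (a w))"
    "has_wirtinger a b (\<lambda>w. of_real ((Uxx (Im w, Re w) + Uyy (Im w, Re w)) / 4))"
    "continuous_on UNIV b"
    and dx: "\<And>x y. deriv (deriv (\<lambda>x. ?U (x, y))) x = Uxx (x, y)"
    and dy: "\<And>x y. deriv (deriv (\<lambda>y. ?U (x, y))) y = Uyy (x, y)"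
    by (rule planar_C2_wirtinger[OF regular]) blast
  have U: "?U (Im w, Re w) = u (cis (Im w), Re w)" for w by (simp add: cyl_lift_def)
  have eq: "Uxx (x, y) + Uyy (x, y) = - exp (2 * u (cis x, y))" for x y
  proof -
    \<comment> \<open>\<open>cyl_laplacian\<close> differentiates at rotation angle
      \<open>0\<close>; as \<open>cis s * cis x = cis (s + x)\<close>, this is the
      \<theta>-derivative of the lift at \<open>x\<close>.\<close>
    have "deriv (deriv (\<lambda>s. ?U (s + x, y))) 0 = Uxx (x, y)"
    proof -
      have shift: "deriv (\<lambda>s. f (s + x)) r = deriv f (r + x)" for f :: "real \<Rightarrow> real" and r
        by (simp add: deriv_def DERIV_shift)
      have "deriv (\<lambda>s. ?U (s + x, y)) = (\<lambda>s. deriv (\<lambda>s. ?U (s, y)) (s + x))"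
        using shift[of "\<lambda>s. ?U (s, y)"] by blast
      then have "deriv (deriv (\<lambda>s. ?U (s + x, y))) 0 = deriv (deriv (\<lambda>s. ?U (s, y))) x"
        using shift[of "deriv (\<lambda>s. ?U (s, y))" 0] by simp
      then show ?thesis by (simp add: dx)
    qed
    then have "cyl_laplacian u (cis x, y) = Uxx (x, y) + Uyy (x, y)"
      using dy[of x y] by (simp add: cyl_laplacian_def cyl_lift_def cis_mult)
    moreover have "(cis x, y) \<in> cylinder" by (simp add: cylinder_def)
    ultimately show ?thesis using solution by (metis add_eq_0_iff2)
  qed
  obtain f' :: "real \<times> real \<Rightarrow> (real \<times> real) \<Rightarrow>\<^sub>L real" where "\<And>p. (?U has_derivative f' p) (at p)" using regular unfolding C2_def by blast
  then have "continuous_on UNIV ?U" using has_derivative_continuous continuous_at_imp_continuous_on by blast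
  from cyl_area_bounds_integral[OF this finite_total_curvature] obtain K where
    K: "\<And>R. integral {-R..R} (\<lambda>t. integral {0..2*pi} (\<lambda>\<theta>. exp (2 * ?U (\<theta>, t)))) \<le> K" by blast
  have "liouville_cylinder (\<lambda>w. u (cis (Im w), Re w)) a b K"
  proof
    show "has_wirtinger (\<lambda>w. of_real (u (cis (Im w), Re w))) a (\<lambda>w. cnj (a w))" using W(1) by (simp add: U)
    show "has_wirtinger a b (\<lambda>w. of_real (- (exp (2 * u (cis (Im w), Re w)) / 4)))"
      using W(2) by (simp add: eq)
    show "u (cis (Im (w + 2 * of_real pi * \<i>)), Re (w + 2 * of_real pi * \<i>)) = u (cis (Im w), Re w)" for w
      by (simp add: cis.code)
    show "integral {-R..R} (\<lambda>t. integral {0..2*pi} (\<lambda>y. exp (2 * u (cis (Im (Complex t y)), Re (Complex t y))))) \<le> K" for R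
      using K[of R] by (simp add: cyl_lift_def)
  qed (rule W(3))
  then show ?thesis by blast
qed

section \<open>Normalization by rescaling and rotation\<close>

theorem theorem1:
  fixes u :: "complex \<times> real \<Rightarrow> real"
  assumes regular: "C2 (cyl_lift u)"
    and solution: "\<forall>p\<in>cylinder. cyl_laplacian u p + exp (2 * u p) = 0"
    and finite_total_curvature: "(\<integral>\<^sup>+ p. ennreal (exp (2 * u p)) \<partial>cyl_area) < \<infinity>"
  shows "\<exists>(\<mu>::real) (\<beta>::real) (c::complex).
           \<mu> \<ge> 0 \<and> \<beta> > -1 \<and> (\<beta> \<in> \<int> \<or> \<mu> = 0) \<and> c \<noteq> 0 \<and>
           (\<forall>z::complex. z \<noteq> 0 \<longrightarrow>
              exp (2 * u (cyl_point (c * z))) =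
                (2 * \<beta> + 2)\<^sup>2 * cmod z powr (2 * \<beta> + 2) /
                ((cmod (1 + complex_of_real \<mu> * z powr complex_of_real (\<beta> + 1)))\<^sup>2
                   + cmod z powr (2 * \<beta> + 2))\<^sup>2)"
proof -
  obtain a b K where "liouville_cylinder (\<lambda>w. u (cis (Im w), Re w)) a b K"
    using cyl_lift_liouville[OF assms] by blast
  then interpret liouville_cylinder "\<lambda>w. u (cis (Im w), Re w)" a b K .
  obtain \<alpha> A D B where \<alpha>: "\<alpha> > 0" and AD: "A > 0" "D > 0" "A * D = \<alpha>\<^sup>2 / 4 + (cmod B)\<^sup>2"
    and int: "B = 0 \<or> \<alpha> \<in> \<int>"
    and h: "\<And>w. \<alpha>\<^sup>2 * h w = A * exp (\<alpha> * Re w) + D * exp (- \<alpha> * Re w) - 2 * Re (B * cis (\<alpha> * Im w))"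
    using classification by blast
  \<comment> \<open>With this \<mu>, the relation for \<open>A * D\<close> turns the coefficient
    \<open>2 * (A * D) / \<alpha>\<close> into
    \<open>\<alpha> / 2 * (1 + \<mu>\<^sup>2)\<close>.\<close>
  define \<mu> where "\<mu> = 2 * cmod B / \<alpha>"
  \<comment> \<open>The rotation by \<phi> turns \<open>B\<close> into \<open>- cmod B\<close>, so
    that the oscillating term becomes the cross term of
    \<open>\<bar>1 + \<mu> z\<^sup>\<alpha>\<bar>\<^sup>2\<close> with a nonnegative \<mu>.\<close>
  define \<phi> where "\<phi> = Arg (- cnj B) / \<alpha>"
  \<comment> \<open>Chosen so that \<open>D * exp (- \<alpha> * Re w)\<close> becomes
    \<open>\<alpha> / (2 * P)\<close>.\<close>
  define \<rho> where "\<rho> = (2 * D / \<alpha>) powr (1 / \<alpha>)"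
  define c where "c = of_real \<rho> * cis \<phi>"
  have \<rho>: "\<rho> > 0" "\<rho> powr \<alpha> = 2 * D / \<alpha>" using AD \<alpha> by (simp_all add: \<rho>_def powr_powr)
  have B: "B * cis (\<alpha> * \<phi>) = - of_real (cmod B)"
  proof (cases "B = 0")
    case False
    then have "cis (\<alpha> * \<phi>) = - cnj B / of_real (cmod B)"
      using \<alpha> by (simp add: \<phi>_def cis_Arg sgn_eq)
    then have "B * cis (\<alpha> * \<phi>) = - (B * cnj B) / of_real (cmod B)" by simp
    also have "\<dots> = - of_real (cmod B)"
      using False by (simp add: power2_eq_square flip: complex_norm_square)
    finally show ?thesis .
  qed simp
  have "exp (2 * u (cyl_point (c * z))) = (2 * \<alpha>)\<^sup>2 * cmod z powr (2 * \<alpha>) /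
      ((cmod (1 + of_real \<mu> * z powr of_real \<alpha>))\<^sup>2 + cmod z powr (2 * \<alpha>))\<^sup>2" if z: "z \<noteq> 0" for z
  proof -
    define P where "P = cmod z powr \<alpha>"
    \<comment> \<open>A lift of \<open>c * z\<close> to the plane. Since
      \<open>\<phi> + Arg z\<close> is not reduced modulo \<open>2 * pi\<close>, the angle
      \<open>\<alpha> * Arg z\<close> is that of the principal power \<open>z powr \<alpha>\<close>,
      also for non-integer \<alpha>.\<close>
    define w where "w = Complex (ln (\<rho> * cmod z)) (\<phi> + Arg z)"
    have P: "P > 0" using z by (simp add: P_def)
    have "cyl_point (c * z) = (cis (Im w), Re w)"
      using \<rho>(1) z by (simp add: cyl_point_def c_def w_def norm_mult cis_Arg flip: cis_mult)
        (simp add: sgn_mult sgn_of_real)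
    then have hw: "exp (2 * u (cyl_point (c * z))) = 1 / (h w)\<^sup>2"
      by (simp add: h_def exp_minus field_simps flip: exp_double)
    have E: "exp (\<alpha> * Re w) = 2 * D / \<alpha> * P"
    proof -
      have "exp (\<alpha> * Re w) = (\<rho> * cmod z) powr \<alpha>" using \<rho>(1) z by (simp add: w_def powr_def)
      also have "\<dots> = \<rho> powr \<alpha> * P" using \<rho>(1) by (simp add: powr_mult P_def)
      finally show ?thesis by (simp add: \<rho>(2))
    qed
    have "B * cis (\<alpha> * Im w) = - of_real (cmod B) * cis (\<alpha> * Arg z)"
      unfolding B[symmetric] by (simp add: w_def distrib_left mult.assoc cis_mult)
    then have R: "Re (B * cis (\<alpha> * Im w)) = - (cmod B * cos (\<alpha> * Arg z))" by simp
    have zp: "z powr of_real \<alpha> = of_real P * cis (\<alpha> * Arg z)"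
    proof -
      have "of_real \<alpha> * Ln z = of_real (\<alpha> * ln (cmod z)) + \<i> * of_real (\<alpha> * Arg z)"
        using z by (simp add: complex_eq_iff Arg_eq_Im_Ln)
      then show ?thesis using z by (simp add: powr_def P_def exp_add cis_conv_exp flip: exp_of_real)
    qed
    have N: "(cmod (1 + of_real \<mu> * z powr of_real \<alpha>))\<^sup>2 = 1 + 2 * \<mu> * P * cos (\<alpha> * Arg z) + \<mu>\<^sup>2 * P\<^sup>2"
      unfolding zp cmod_power2
      by (simp add: power_mult_distrib power2_sum sin_squared_eq algebra_simps)
    have P2: "cmod z powr (2 * \<alpha>) = P\<^sup>2"
      by (simp add: P_def power2_eq_square flip: powr_add)
    have "\<alpha>\<^sup>2 * h w = A * (2 * D / \<alpha> * P) + D * (\<alpha> / (2 * D * P)) + 2 * (cmod B * cos (\<alpha> * Arg z))"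
    proof -
      have "exp (- \<alpha> * Re w) = \<alpha> / (2 * D * P)"
        using E by (simp add: exp_minus)
      then show ?thesis using h[of w] E R by simp
    qed
    also have "\<dots> = 2 * (A * D) / \<alpha> * P + \<alpha> / (2 * P) + 2 * (cmod B * cos (\<alpha> * Arg z))"
      using AD by simp
    also have "\<dots> = \<alpha> / (2 * P) * ((1 + 2 * \<mu> * P * cos (\<alpha> * Arg z) + \<mu>\<^sup>2 * P\<^sup>2) + P\<^sup>2)"
      unfolding AD(3) using \<alpha> P by (simp add: \<mu>_def field_simps power2_eq_square)
    also have "\<dots> = \<alpha>\<^sup>2 * (((1 + 2 * \<mu> * P * cos (\<alpha> * Arg z) + \<mu>\<^sup>2 * P\<^sup>2) + P\<^sup>2) / (2 * \<alpha> * P))"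
      using \<alpha> P by (simp add: power2_eq_square)
    finally have "h w = ((1 + 2 * \<mu> * P * cos (\<alpha> * Arg z) + \<mu>\<^sup>2 * P\<^sup>2) + P\<^sup>2) / (2 * \<alpha> * P)"
      using \<alpha> by (simp only: mult_cancel_left) simp
    then show ?thesis
      unfolding hw N P2 by (simp add: power_divide power_mult_distrib)
  qed
  moreover have "\<mu> \<ge> 0" "\<alpha> - 1 > -1" "\<alpha> - 1 \<in> \<int> \<or> \<mu> = 0" "c \<noteq> 0"
    using \<alpha> int \<rho> by (auto simp: \<mu>_def c_def)
  ultimately show ?thesis
    by (intro exI[of _ \<mu>] exI[of _ "\<alpha> - 1"] exI[of _ c]) (simp add: algebra_simps)
qed

end
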